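(* Let $H$ be any fixed graph that has no self-loops and is not bipartite. Then \textsc{$H$-Coloring} parameterized by the size $k$ of a twin-cover of the input graph has a kernel with $\mathcal{O}(k^{\Delta(H)})$ vertices and edges, which can be encoded in $\mathcal{O}(k^{\Delta(H)}\log k)$ bits. That is, there is a polynomial-time algorithm that, given a graph $G$ that has a twin-cover of size $k$, outputs a graph $G'$ with $\mathcal{O}(k^{\Delta(H)})$ vertices and edges (encodable in $\mathcal{O}(k^{\Delta(H)}\log k)$ bits) such that $G'$ is $H$-colorable if and only if $G$ is $H$-colorable. Furthermore, the kernelized instance $G'$ is a subgraph of the original input graph $G$.
   Context: All graphs are finite, simple and undirected. For a graph $G$ and $u\in V(G)$, $N_G[u]$ denotes the closed neighborhood of $u$. Two vertices $u,v$ are (true) twins if $N_G[u]=N_G[v]$. A set $X\subseteq V(G)$ is a twin-cover of $G$ if for every edge $\{u,v\}\in E(G)$, $u\in X$ or $v\in X$ or $u$ and $v$ are twins. A graph $G$ is $H$-colorable if there is a map $f\colon V(G)\to V(H)$ with $\{f(u),f(v)\}\in E(H)$ for every $\{u,v\}\in E(G)$ (a homomorphism); \textsc{$H$-Coloring} asks whether the input graph $G$ is $H$-colorable. $\Delta(H)$ is the maximum degree of $H$. The constants hidden in the $\mathcal{O}$-notation may depend on $H$. *)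

theory Defs
  imports
    "HOL-Library.Landau_Symbols"
    "HOL-Computational_Algebra.Polynomial"
begin

section \<open>Graphs\<close>

record 'a ugraph =
  verts :: "'a set"
  edges :: "'a set set"

definition simple_graph :: "'a ugraph \<Rightarrow> bool" where
  "simple_graph G \<longleftrightarrow> finite (verts G) \<and>
     (\<forall>e \<in> edges G. \<exists>u \<in> verts G. \<exists>v \<in> verts G. u \<noteq> v \<and> e = {u, v})"

definition subgraph :: "'a ugraph \<Rightarrow> 'a ugraph \<Rightarrow> bool" where
  "subgraph G' G \<longleftrightarrow> verts G' \<subseteq> verts G \<and> edges G' \<subseteq> edges G"

definition closed_nbhd :: "'a ugraph \<Rightarrow> 'a \<Rightarrow> 'a set" where
  "closed_nbhd G u = insert u {v \<in> verts G. {u, v} \<in> edges G}"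

definition twins :: "'a ugraph \<Rightarrow> 'a \<Rightarrow> 'a \<Rightarrow> bool" where
  "twins G u v \<longleftrightarrow> closed_nbhd G u = closed_nbhd G v"

definition twin_cover :: "'a ugraph \<Rightarrow> 'a set \<Rightarrow> bool" where
  "twin_cover G X \<longleftrightarrow> X \<subseteq> verts G \<and>
     (\<forall>u v. {u, v} \<in> edges G \<longrightarrow> u \<in> X \<or> v \<in> X \<or> twins G u v)"

definition colorable :: "'h ugraph \<Rightarrow> 'a ugraph \<Rightarrow> bool" where
  "colorable H G \<longleftrightarrow> (\<exists>f. f ` verts G \<subseteq> verts H \<and>
     (\<forall>u v. {u, v} \<in> edges G \<longrightarrow> {f u, f v} \<in> edges H))"

definition bipartite :: "'a ugraph \<Rightarrow> bool" where
  "bipartite G \<longleftrightarrow> (\<exists>A B. A \<union> B = verts G \<and> A \<inter> B = {} \<and>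
     (\<forall>e \<in> edges G. \<exists>a \<in> A. \<exists>b \<in> B. e = {a, b}))"

definition vertex_degree :: "'a ugraph \<Rightarrow> 'a \<Rightarrow> nat" where
  "vertex_degree G v = card {u \<in> verts G. {v, u} \<in> edges G}"

definition max_degree :: "'a ugraph \<Rightarrow> nat" where
  "max_degree G = Max (vertex_degree G ` verts G)"


section \<open>Computation\<close>

text \<open>
  The machine model is the WHILE language of Jones (Computability and Complexity from a
  Programming Perspective): structured programs over variables that hold binary trees.
  Jones charges one unit per elementary operation. Here an assignment costs in addition the size
  of the tree it stores, so that no tree larger than input plus running time can be built, and
  polynomial time is the same notion as for Turing machines, also for functions.
\<close>

datatype tree = Leaf | Node tree tree

datatype expr = Const_Leaf | Copy nat | Join nat nat | Head nat | Tail nat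

datatype com =
    Assign nat expr
  | Seq com com
  | Cond nat com com
  | While nat com

type_synonym store = "nat \<Rightarrow> tree"

fun head :: "tree \<Rightarrow> tree" where
  "head Leaf = Leaf"
| "head (Node l r) = l"

fun tail :: "tree \<Rightarrow> tree" where
  "tail Leaf = Leaf"
| "tail (Node l r) = r"

fun eval :: "expr \<Rightarrow> store \<Rightarrow> tree" where
  "eval Const_Leaf s = Leaf"
| "eval (Copy y) s = s y"
| "eval (Join y z) s = Node (s y) (s z)"
| "eval (Head y) s = head (s y)"
| "eval (Tail y) s = tail (s y)"

text \<open>
  \<open>exec c s t s'\<close>: started in \<open>s\<close>, \<open>c\<close> terminates in \<open>s'\<close> after time \<open>t\<close>.
  A test on variable \<open>x\<close> asks whether \<open>x\<close> holds a tree other than \<^term>\<open>Leaf\<close>.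
\<close>

inductive exec :: "com \<Rightarrow> store \<Rightarrow> nat \<Rightarrow> store \<Rightarrow> bool" where
  Assign: "exec (Assign x e) s (1 + size (eval e s)) (s(x := eval e s))"
| Seq: "exec c1 s t1 s1 \<Longrightarrow> exec c2 s1 t2 s2 \<Longrightarrow> exec (Seq c1 c2) s (t1 + t2) s2"
| Cond_True: "s x \<noteq> Leaf \<Longrightarrow> exec c1 s t s' \<Longrightarrow> exec (Cond x c1 c2) s (1 + t) s'"
| Cond_False: "s x = Leaf \<Longrightarrow> exec c2 s t s' \<Longrightarrow> exec (Cond x c1 c2) s (1 + t) s'"
| While_False: "s x = Leaf \<Longrightarrow> exec (While x c) s 1 s"
| While_True: "s x \<noteq> Leaf \<Longrightarrow> exec c s t1 s1 \<Longrightarrow> exec (While x c) s1 t2 s2 \<Longrightarrow>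
    exec (While x c) s (1 + t1 + t2) s2"

inductive_cases exec_AssignE: "exec (Assign x e) s t s'"
inductive_cases exec_SeqE: "exec (Seq c1 c2) s t s'"
inductive_cases exec_CondE: "exec (Cond x c1 c2) s t s'"
inductive_cases exec_WhileE: "exec (While x c) s t s'"

lemma exec_deterministic:
  "exec c s t s' \<Longrightarrow> exec c s u s'' \<Longrightarrow> u = t \<and> s'' = s'"
proof (induction arbitrary: u s'' rule: exec.induct)
  case Assign
  then show ?case by (auto elim: exec_AssignE)
next
  case (Seq c1 s t1 s1 c2 t2 s2)
  from Seq.prems obtain u1 r u2 where "u = u1 + u2" "exec c1 s u1 r" "exec c2 r u2 s''"
    by (rule exec_SeqE)
  with Seq.IH(1) [of u1 r] Seq.IH(2) [of u2 s''] show ?case by simp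
next
  case (Cond_True s x c1 t s' c2)
  from Cond_True.prems Cond_True.hyps obtain v where "u = 1 + v" "exec c1 s v s''"
    by (auto elim: exec_CondE)
  with Cond_True.IH [of v s''] show ?case by simp
next
  case (Cond_False s x c2 t s' c1)
  from Cond_False.prems Cond_False.hyps obtain v where "u = 1 + v" "exec c2 s v s''"
    by (auto elim: exec_CondE)
  with Cond_False.IH [of v s''] show ?case by simp
next
  case (While_False s x c)
  from While_False.prems show ?case
    by (rule exec_WhileE) (simp_all add: While_False.hyps)
next
  case (While_True s x c t1 s1 t2 s2)
  from While_True.prems obtain u1 r u2
    where "u = 1 + u1 + u2" "exec c s u1 r" "exec (While x c) r u2 s''"
    by (rule exec_WhileE) (use While_True.hyps(1) in auto)
  with While_True.IH(1) [of u1 r] While_True.IH(2) [of u2 s''] show ?case by simp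
qed

definition runs :: "com \<Rightarrow> tree \<Rightarrow> nat \<Rightarrow> tree \<Rightarrow> bool" where
  "runs c x t y \<longleftrightarrow> (\<exists>s. exec c ((\<lambda>_. Leaf)(0 := x)) t s \<and> s 0 = y)"

definition polytime_on :: "tree set \<Rightarrow> (tree \<Rightarrow> tree) \<Rightarrow> bool" where
  "polytime_on A f \<longleftrightarrow>
     (\<exists>c (q :: nat poly). \<forall>x \<in> A. \<exists>t. runs c x t (f x) \<and> t \<le> poly q (size x))"


section \<open>Encodings\<close>

text \<open>Binary representation, least significant bit first, without leading zeros.\<close>

fun nat_bits :: "nat \<Rightarrow> bool list" where
  "nat_bits n = (if n = 0 then [] else odd n # nat_bits (n div 2))"

declare nat_bits.simps [simp del]

fun list_tree :: "tree list \<Rightarrow> tree" where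
  "list_tree [] = Leaf"
| "list_tree (x # xs) = Node x (list_tree xs)"

definition bool_tree :: "bool \<Rightarrow> tree" where
  "bool_tree b = (if b then Node Leaf Leaf else Leaf)"

definition bits_tree :: "bool list \<Rightarrow> tree" where
  "bits_tree bs = list_tree (map bool_tree bs)"

definition nat_tree :: "nat \<Rightarrow> tree" where
  "nat_tree n = bits_tree (nat_bits n)"

definition graph_tree :: "nat list \<Rightarrow> (nat \<times> nat) list \<Rightarrow> tree" where
  "graph_tree vs es =
     Node (list_tree (map nat_tree vs))
       (list_tree (map (\<lambda>(u, v). Node (nat_tree u) (nat_tree v)) es))"

definition lists_graph :: "'a list \<Rightarrow> ('a \<times> 'a) list \<Rightarrow> 'a ugraph \<Rightarrow> bool" where
  "lists_graph vs es G \<longleftrightarrow>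
     distinct vs \<and> set vs = verts G \<and>
     distinct (map (\<lambda>(u, v). {u, v}) es) \<and> set (map (\<lambda>(u, v). {u, v}) es) = edges G"

definition tree_encodes :: "tree \<Rightarrow> nat ugraph \<Rightarrow> bool" where
  "tree_encodes x G \<longleftrightarrow> (\<exists>vs es. lists_graph vs es G \<and> x = graph_tree vs es)"

text \<open>
  The bit encoding of a graph on \<open>{0..<n}\<close> gives \<open>n\<close> in unary, followed by the endpoints of
  the edges as binary numbers of fixed width. Other graphs are first relabelled, so a bit string
  determines a graph only up to isomorphism; names taken from a larger graph need not be stored.
\<close>

definition fixed_bits :: "nat \<Rightarrow> nat \<Rightarrow> bool list" where
  "fixed_bits w v = map (bit v) [0..<w]"

definition bit_code :: "nat \<Rightarrow> (nat \<times> nat) list \<Rightarrow> bool list" where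
  "bit_code n es = replicate n True @ False #
     concat (map (\<lambda>(u, v). fixed_bits (length (nat_bits n)) u @
                            fixed_bits (length (nat_bits n)) v) es)"

definition bits_encode :: "bool list \<Rightarrow> 'a ugraph \<Rightarrow> bool" where
  "bits_encode w G \<longleftrightarrow> (\<exists>vs es \<phi>. lists_graph vs es G \<and>
     bij_betw \<phi> (verts G) {0..<card (verts G)} \<and>
     w = bit_code (card (verts G)) (map (\<lambda>(u, v). (\<phi> u, \<phi> v)) es))"

end

theory Submission
  imports Defs
begin

text \<open>
  Let \<open>d\<close> be the maximum degree of \<open>H\<close>; it is at least 2 because \<open>H\<close> is not bipartite. The
  endpoints of a maximal matching among the edges between non-twins form a set \<open>X\<close> of at most
  \<open>2k\<close> vertices such that \<open>G - X\<close> is a disjoint union of cliques of twins. A colouring of \<open>X\<close>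
  extends to such a clique of size \<open>s\<close> with neighbourhood \<open>N \<subseteq> X\<close> iff the colours of \<open>N\<close> have a
  common neighbourhood in \<open>H\<close> containing a clique of size \<open>s\<close>. A minimal set of colours violating
  this has at most \<open>d - s + 2\<close> elements. Violations by at most \<open>d\<close> vertices \<open>S \<subseteq> X\<close> are preserved
  by keeping, for each \<open>S\<close> and each \<open>s \<le> d + 2\<close>, one clique of size \<open>s\<close> adjacent to \<open>S\<close>.

  What remains is \<open>s = 1\<close> and \<open>|S| = d + 1\<close>, where the condition on \<open>S\<close> is that the colouring \<open>f\<close>
  is not injective on \<open>S\<close>. There are too many such \<open>S\<close>, but it suffices to keep those whose
  boundaries (the sets of their \<open>d\<close>-element faces, as vectors over the two-element field) form a
  basis of the span of all boundaries, hence at most \<open>|X| ^ d\<close> of them. Fix \<open>d\<close> colours: if \<open>f\<close> is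
  injective on \<open>S\<close> and uses them, exactly one face of \<open>S\<close> carries precisely these colours, whereas
  the number of such faces is even if \<open>f\<close> is not injective on \<open>S\<close>. So if all kept \<open>S\<close> satisfy
  their condition, then by linearity all of them do.
\<close>

section \<open>Polynomial-time functions between encoded types\<close>

class enc =
  fixes enc :: "'a \<Rightarrow> tree"
  assumes enc_inject: "enc a = enc b \<Longrightarrow> a = b"

lemma inj_enc: "inj enc"
  by (simp add: enc_inject inj_def)

instantiation bool :: enc
begin
definition enc_bool :: "bool \<Rightarrow> tree" where "enc_bool = bool_tree"
instance by standard (auto simp: enc_bool_def bool_tree_def split: if_splits)
end

instantiation prod :: (enc, enc) enc
begin
definition enc_prod :: "'a \<times> 'b \<Rightarrow> tree" where "enc_prod p = Node (enc (fst p)) (enc (snd p))"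
instance by standard (auto simp: enc_prod_def prod_eq_iff dest: enc_inject)
end

instantiation list :: (enc) enc
begin
definition enc_list :: "'a list \<Rightarrow> tree" where "enc_list xs = list_tree (map enc xs)"
instance
proof
  fix xs ys :: "'a list"
  show "enc xs = enc ys \<Longrightarrow> xs = ys"
  proof (induction xs arbitrary: ys)
    case Nil
    then show ?case by (cases ys) (auto simp: enc_list_def)
  next
    case (Cons x xs)
    then show ?case by (cases ys) (auto simp: enc_list_def dest: enc_inject)
  qed
qed
end

lemma nat_bits_inject: "nat_bits m = nat_bits n \<Longrightarrow> m = n"
proof (induction m arbitrary: n rule: less_induct)
  case (less m)
  show ?case
  proof (cases "m = 0 \<or> n = 0")
    case True
    with less.prems show ?thesis
      by (subst (asm) nat_bits.simps[of m], subst (asm) nat_bits.simps[of n]) (auto split: if_splits)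
  next
    case False
    with less.prems have "odd m = odd n" and "nat_bits (m div 2) = nat_bits (n div 2)"
      by (simp_all add: nat_bits.simps[of m] nat_bits.simps[of n])
    moreover from this False have "m div 2 = n div 2"
      by (intro less.IH) auto
    ultimately show ?thesis
      by (metis div_mult_mod_eq odd_iff_mod_2_eq_one even_iff_mod_2_eq_zero)
  qed
qed

instantiation nat :: enc
begin
definition enc_nat :: "nat \<Rightarrow> tree" where "enc_nat = nat_tree"
instance
  by standard (auto simp: enc_nat_def nat_tree_def bits_tree_def enc_bool_def[symmetric]
      enc_list_def[symmetric] dest!: enc_inject intro: nat_bits_inject)
end

lemma enc_Nil [simp]: "enc [] = Leaf"
  and enc_Cons [simp]: "enc (x # xs) = Node (enc x) (enc xs)"
  by (simp_all add: enc_list_def)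

lemma enc_Pair [simp]: "enc (x, y) = Node (enc x) (enc y)"
  by (simp add: enc_prod_def)

lemma enc_True [simp]: "enc True = Node Leaf Leaf"
  and enc_False [simp]: "enc False = Leaf"
  by (simp_all add: enc_bool_def bool_tree_def)

text \<open>\<open>enc_nat\<close> already stores the bit list, so passing from a number to its
  binary digits leaves the tree unchanged.\<close>

lemma enc_nat_bits: "enc (nat_bits n) = enc n"
  by (simp add: enc_nat_def nat_tree_def bits_tree_def enc_bool_def enc_list_def)

section \<open>Programs and their polynomial time bounds\<close>

lemma poly_nat_mono: "x \<le> y \<Longrightarrow> poly p x \<le> poly p (y :: nat)"
  by (induction p) (auto intro!: add_mono mult_mono)

text \<open>
  The bound \<open>b\<close> separates the registers that the code must preserve (except the result \<open>r\<close>) from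
  the scratch registers; quantifying over it makes all closure properties a matter of choosing
  fresh registers, so that programs never have to be renamed.
\<close>

definition implements ::
  "com \<Rightarrow> nat \<Rightarrow> nat \<Rightarrow> nat \<Rightarrow> ('a::enc \<Rightarrow> 'b::enc) \<Rightarrow> nat poly \<Rightarrow> bool" where
  "implements c b i r f q \<longleftrightarrow> (\<forall>s a. s i = enc a \<longrightarrow>
     (\<exists>t s'. exec c s t s' \<and> t \<le> poly q (size (enc a)) \<and> s' r = enc (f a) \<and>
       (\<forall>v<b. v \<noteq> r \<longrightarrow> s' v = s v)))"

text \<open>The polynomial is fixed before the registers, so it does not depend on where the program
  is placed. It also bounds the output size, which is the input size of the second program in a
  composition.\<close>

definition polytime :: "('a::enc \<Rightarrow> 'b::enc) \<Rightarrow> bool" where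
  "polytime f \<longleftrightarrow> (\<exists>q. (\<forall>a. size (enc (f a)) \<le> poly q (size (enc a))) \<and>
     (\<forall>b i r. i < b \<longrightarrow> r < b \<longrightarrow> (\<exists>c. implements c b i r f q)))"

named_theorems polytime_intros

lemma implementsE:
  assumes "implements c b i r f q" and "s i = enc a"
  obtains t s' where "exec c s t s'" "t \<le> poly q (size (enc a))" "s' r = enc (f a)"
    "\<And>v. v < b \<Longrightarrow> v \<noteq> r \<Longrightarrow> s' v = s v"
  using assms unfolding implements_def by blast

lemma implementsI:
  assumes "\<And>s a. s i = enc a \<Longrightarrow> \<exists>t s'. exec c s t s' \<and> t \<le> poly q (size (enc a)) \<and>
    s' r = enc (f a) \<and> (\<forall>v<b. v \<noteq> r \<longrightarrow> s' v = s v)"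
  shows "implements c b i r f q"
  using assms unfolding implements_def by blast

lemma polytimeE:
  assumes "polytime f"
  obtains q where "\<And>a. size (enc (f a)) \<le> poly q (size (enc a))"
    "\<And>b i r. i < b \<Longrightarrow> r < b \<Longrightarrow> \<exists>c. implements c b i r f q"
  using assms unfolding polytime_def by blast

lemma polytimeI:
  assumes "\<And>a. size (enc (f a)) \<le> poly q (size (enc a))"
    "\<And>b i r. i < b \<Longrightarrow> r < b \<Longrightarrow> \<exists>c. implements c b i r f q"
  shows "polytime f"
  using assms unfolding polytime_def by blast

text \<open>Changes of type that leave the tree alone, such as from a pair to a nonempty list,
  amount to a copy.\<close>

lemma polytime_retype:
  assumes "\<And>a. enc (f a) = enc a"
  shows "polytime f"
proof (rule polytimeI[where q = "[:1, 1:]"])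
  fix b i r :: nat
  have "implements (Assign r (Copy i)) b i r f [:1, 1:]"
  proof (rule implementsI)
    fix s :: store and a :: 'a
    assume "s i = enc a"
    then show "\<exists>t s'. exec (Assign r (Copy i)) s t s' \<and> t \<le> poly [:1, 1:] (size (enc a)) \<and>
        s' r = enc (f a) \<and> (\<forall>v<b. v \<noteq> r \<longrightarrow> s' v = s v)"
      using exec.Assign[of r "Copy i" s] assms by fastforce
  qed
  then show "\<exists>c. implements c b i r f [:1, 1:]" ..
qed (simp add: assms)

lemma polytime_id [polytime_intros]: "polytime (\<lambda>a. a)"
  by (rule polytime_retype) simp

text \<open>The intermediate value goes into \<open>b\<close>, the first register outside the
  protected range. The time of \<open>g\<close> is bounded by its polynomial at the output size of
  \<open>f\<close>, whence \<open>pcompose p q\<close>.\<close>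

lemma polytime_comp:
  fixes f :: "'a::enc \<Rightarrow> 'b::enc"
  assumes "polytime g" and "polytime f"
  shows "polytime (\<lambda>a. g (f a))"
proof -
  obtain p where p: "\<And>a. size (enc (g a)) \<le> poly p (size (enc a))"
    "\<And>b i r. i < b \<Longrightarrow> r < b \<Longrightarrow> \<exists>c. implements c b i r g p"
    using assms(1) by (rule polytimeE) blast
  obtain q where q: "\<And>a. size (enc (f a)) \<le> poly q (size (enc a))"
    "\<And>b i r. i < b \<Longrightarrow> r < b \<Longrightarrow> \<exists>c. implements c b i r f q"
    using assms(2) by (rule polytimeE) blast
  have mono: "poly p (size (enc (f a))) \<le> poly p (poly q (size (enc a)))" for a
    by (intro poly_nat_mono q(1))
  show ?thesis
  proof (rule polytimeI[where q = "q + pcompose p q"])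
    show "size (enc (g (f a))) \<le> poly (q + pcompose p q) (size (enc a))" for a
      using p(1)[of "f a"] mono[of a] by (simp add: poly_pcompose)
  next
    fix b i r :: nat
    assume less: "i < b" "r < b"
    obtain c1 where c1: "implements c1 (b + 1) i b f q" using q(2)[of i "b + 1" b] less by auto
    obtain c2 where c2: "implements c2 (b + 1) b r g p" using p(2)[of b "b + 1" r] less by auto
    have "implements (Seq c1 c2) b i r (\<lambda>a. g (f a)) (q + pcompose p q)"
    proof (rule implementsI)
      fix s :: store and a :: 'a
      assume "s i = enc a"
      with c1 obtain t1 s1 where 1: "exec c1 s t1 s1" "t1 \<le> poly q (size (enc a))"
        "s1 b = enc (f a)" "\<And>v. v < b + 1 \<Longrightarrow> v \<noteq> b \<Longrightarrow> s1 v = s v"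
        by (rule implementsE) blast
      from c2 1(3) obtain t2 s2 where 2: "exec c2 s1 t2 s2" "t2 \<le> poly p (size (enc (f a)))"
        "s2 r = enc (g (f a))" "\<And>v. v < b + 1 \<Longrightarrow> v \<noteq> r \<Longrightarrow> s2 v = s1 v"
        by (rule implementsE) blast
      show "\<exists>t s'. exec (Seq c1 c2) s t s' \<and> t \<le> poly (q + pcompose p q) (size (enc a)) \<and>
          s' r = enc (g (f a)) \<and> (\<forall>v<b. v \<noteq> r \<longrightarrow> s' v = s v)"
        using exec.Seq[OF 1(1) 2(1)] 1 2 mono[of a]
        by (intro exI[of _ "t1 + t2"] exI[of _ s2]) (auto simp: poly_pcompose)
    qed
    then show "\<exists>c. implements c b i r (\<lambda>a. g (f a)) (q + pcompose p q)" ..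
  qed
qed

lemma polytime_fst [polytime_intros]:
  fixes f :: "'e::enc \<Rightarrow> 'c::enc \<times> 'd::enc"
  assumes "polytime f"
  shows "polytime (\<lambda>e. fst (f e))"
proof -
  have "polytime (fst :: 'c \<times> 'd \<Rightarrow> 'c)"
  proof (rule polytimeI[where q = "[:1, 1:]"])
    fix b i r :: nat
    have "implements (Assign r (Head i)) b i r (fst :: 'c \<times> 'd \<Rightarrow> 'c) [:1, 1:]"
    proof (rule implementsI)
      fix s :: store and a :: "'c \<times> 'd"
      assume "s i = enc a"
      then show "\<exists>t s'. exec (Assign r (Head i)) s t s' \<and> t \<le> poly [:1, 1:] (size (enc a)) \<and>
          s' r = enc (fst a) \<and> (\<forall>v<b. v \<noteq> r \<longrightarrow> s' v = s v)"
        using exec.Assign[of r "Head i" s]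
        by (intro exI[of _ "1 + size (enc (fst a))"] exI[of _ "s(r := enc (fst a))"])
          (auto simp: enc_prod_def)
    qed
    then show "\<exists>c. implements c b i r (fst :: 'c \<times> 'd \<Rightarrow> 'c) [:1, 1:]" ..
  qed (simp add: enc_prod_def)
  from polytime_comp[OF this assms] show ?thesis .
qed

lemma polytime_snd [polytime_intros]:
  fixes f :: "'e::enc \<Rightarrow> 'c::enc \<times> 'd::enc"
  assumes "polytime f"
  shows "polytime (\<lambda>e. snd (f e))"
proof -
  have "polytime (snd :: 'c \<times> 'd \<Rightarrow> 'd)"
  proof (rule polytimeI[where q = "[:1, 1:]"])
    fix b i r :: nat
    have "implements (Assign r (Tail i)) b i r (snd :: 'c \<times> 'd \<Rightarrow> 'd) [:1, 1:]"
    proof (rule implementsI)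
      fix s :: store and a :: "'c \<times> 'd"
      assume "s i = enc a"
      then show "\<exists>t s'. exec (Assign r (Tail i)) s t s' \<and> t \<le> poly [:1, 1:] (size (enc a)) \<and>
          s' r = enc (snd a) \<and> (\<forall>v<b. v \<noteq> r \<longrightarrow> s' v = s v)"
        using exec.Assign[of r "Tail i" s]
        by (intro exI[of _ "1 + size (enc (snd a))"] exI[of _ "s(r := enc (snd a))"])
          (auto simp: enc_prod_def)
    qed
    then show "\<exists>c. implements c b i r (snd :: 'c \<times> 'd \<Rightarrow> 'd) [:1, 1:]" ..
  qed (simp add: enc_prod_def)
  from polytime_comp[OF this assms] show ?thesis .
qed

text \<open>By recursion on the tree: both halves are built in fresh registers and then joined. The
  time \<open>k\<close> depends on \<open>u\<close> alone.\<close>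

lemma const_tree_program:
  "\<exists>k. \<forall>b r. r < b \<longrightarrow> (\<exists>c. \<forall>s. \<exists>t s'. exec c s t s' \<and> t \<le> k \<and> s' r = u \<and>
     (\<forall>v<b. v \<noteq> r \<longrightarrow> s' v = s v))"
proof (induction u)
  case Leaf
  have "\<exists>t s'. exec (Assign r Const_Leaf) s t s' \<and> t \<le> 1 \<and> s' r = Leaf \<and>
      (\<forall>v<b. v \<noteq> r \<longrightarrow> s' v = s v)" for b r s
    using exec.Assign[of r Const_Leaf s] by fastforce
  then show ?case by blast
next
  case (Node u1 u2)
  from Node.IH(1) obtain k1 where k1: "\<And>b r. r < b \<Longrightarrow> \<exists>c. \<forall>s. \<exists>t s'. exec c s t s' \<and> t \<le> k1 \<and>
    s' r = u1 \<and> (\<forall>v<b. v \<noteq> r \<longrightarrow> s' v = s v)" by blast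
  from Node.IH(2) obtain k2 where k2: "\<And>b r. r < b \<Longrightarrow> \<exists>c. \<forall>s. \<exists>t s'. exec c s t s' \<and> t \<le> k2 \<and>
    s' r = u2 \<and> (\<forall>v<b. v \<noteq> r \<longrightarrow> s' v = s v)" by blast
  have "\<exists>c. \<forall>s. \<exists>t s'. exec c s t s' \<and> t \<le> k1 + (k2 + (1 + size (Node u1 u2))) \<and> s' r = Node u1 u2 \<and>
      (\<forall>v<b. v \<noteq> r \<longrightarrow> s' v = s v)" if "r < b" for b r
  proof -
    obtain c1 where c1: "\<And>s. \<exists>t s'. exec c1 s t s' \<and> t \<le> k1 \<and> s' b = u1 \<and>
        (\<forall>v<b + 1. v \<noteq> b \<longrightarrow> s' v = s v)"
      using k1[of b "b + 1"] by auto
    obtain c2 where c2: "\<And>s. \<exists>t s'. exec c2 s t s' \<and> t \<le> k2 \<and> s' (b + 1) = u2 \<and>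
        (\<forall>v<b + 2. v \<noteq> b + 1 \<longrightarrow> s' v = s v)"
      using k2[of "b + 1" "b + 2"] by auto
    let ?c = "Seq c1 (Seq c2 (Assign r (Join b (b + 1))))"
    have "\<exists>t s'. exec ?c s t s' \<and> t \<le> k1 + (k2 + (1 + size (Node u1 u2))) \<and> s' r = Node u1 u2 \<and>
      (\<forall>v<b. v \<noteq> r \<longrightarrow> s' v = s v)" for s
    proof -
      obtain t1 s1 where 1: "exec c1 s t1 s1" "t1 \<le> k1" "s1 b = u1"
        "\<forall>v<b + 1. v \<noteq> b \<longrightarrow> s1 v = s v" using c1 by blast
      obtain t2 s2 where 2: "exec c2 s1 t2 s2" "t2 \<le> k2" "s2 (b + 1) = u2"
        "\<forall>v<b + 2. v \<noteq> b + 1 \<longrightarrow> s2 v = s1 v" using c2 by blast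
      show ?thesis
        using exec.Seq[OF 1(1) exec.Seq[OF 2(1) exec.Assign[of r "Join b (b + 1)" s2]]] 1 2
        by (intro exI[of _ "t1 + (t2 + (1 + size (Node u1 u2)))"]
            exI[of _ "s2(r := Node u1 u2)"]) auto
    qed
    then show ?thesis by blast
  qed
  then show ?case by blast
qed

lemma polytime_const [polytime_intros]: "polytime (\<lambda>_. d)"
proof -
  obtain k where k: "\<And>b r. r < b \<Longrightarrow> \<exists>c. \<forall>s. \<exists>t s'. exec c s t s' \<and> t \<le> k \<and> s' r = enc d \<and>
     (\<forall>v<b. v \<noteq> r \<longrightarrow> s' v = s v)"
    using const_tree_program[of "enc d"] by blast
  show ?thesis
  proof (rule polytimeI[where q = "[:k + size (enc d):]"])
    fix b i r :: nat
    assume "r < b"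
    from k[OF this] obtain c where c: "\<And>s. \<exists>t s'. exec c s t s' \<and> t \<le> k \<and> s' r = enc d \<and>
     (\<forall>v<b. v \<noteq> r \<longrightarrow> s' v = s v)" by blast
    have "implements c b i r (\<lambda>_. d) [:k + size (enc d):]"
    proof (rule implementsI)
      fix s
      show "\<exists>t s'. exec c s t s' \<and> t \<le> poly [:k + size (enc d):] (size (enc a)) \<and> s' r = enc d \<and>
         (\<forall>v<b. v \<noteq> r \<longrightarrow> s' v = s v)" for a :: 'c
        using c[of s] by (force intro: trans_le_add1)
    qed
    then show "\<exists>c. implements c b i r (\<lambda>_. d) [:k + size (enc d):]" ..
  qed simp
qed

lemma polytime_Pair [polytime_intros]:
  assumes "polytime f" and "polytime g"
  shows "polytime (\<lambda>e. (f e, g e))"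
proof -
  obtain p where p: "\<And>a. size (enc (f a)) \<le> poly p (size (enc a))"
    "\<And>b i r. i < b \<Longrightarrow> r < b \<Longrightarrow> \<exists>c. implements c b i r f p"
    using assms(1) by (rule polytimeE) blast
  obtain q where q: "\<And>a. size (enc (g a)) \<le> poly q (size (enc a))"
    "\<And>b i r. i < b \<Longrightarrow> r < b \<Longrightarrow> \<exists>c. implements c b i r g q"
    using assms(2) by (rule polytimeE) blast
  let ?Q = "p + p + q + q + [:2:]"
  show ?thesis
  proof (rule polytimeI[where q = ?Q])
    show "size (enc (f a, g a)) \<le> poly ?Q (size (enc a))" for a
      using p(1)[of a] q(1)[of a] by simp
  next
    fix b i r :: nat
    assume less: "i < b" "r < b"
    obtain c1 where c1: "implements c1 (b + 1) i b f p" using p(2)[of i "b + 1" b] less by auto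
    obtain c2 where c2: "implements c2 (b + 2) i (b + 1) g q"
      using q(2)[of i "b + 2" "b + 1"] less by auto
    let ?c = "Seq c1 (Seq c2 (Assign r (Join b (b + 1))))"
    have "implements ?c b i r (\<lambda>e. (f e, g e)) ?Q"
    proof (rule implementsI)
      fix s :: store and a :: 'a
      assume a: "s i = enc a"
      with c1 obtain t1 s1 where 1: "exec c1 s t1 s1" "t1 \<le> poly p (size (enc a))"
        "s1 b = enc (f a)" "\<And>v. v < b + 1 \<Longrightarrow> v \<noteq> b \<Longrightarrow> s1 v = s v"
        by (rule implementsE) blast
      have "s1 i = enc a" using a 1(4) less by simp
      with c2 obtain t2 s2 where 2: "exec c2 s1 t2 s2" "t2 \<le> poly q (size (enc a))"
        "s2 (b + 1) = enc (g a)" "\<And>v. v < b + 2 \<Longrightarrow> v \<noteq> b + 1 \<Longrightarrow> s2 v = s1 v"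
        by (rule implementsE) blast
      show "\<exists>t s'. exec ?c s t s' \<and> t \<le> poly ?Q (size (enc a)) \<and> s' r = enc (f a, g a) \<and>
          (\<forall>v<b. v \<noteq> r \<longrightarrow> s' v = s v)"
        using exec.Seq[OF 1(1) exec.Seq[OF 2(1) exec.Assign[of r "Join b (b + 1)" s2]]] 1 2
          p(1)[of a] q(1)[of a]
        by (intro exI[of _ "t1 + (t2 + (1 + size (enc (f a, g a))))"]
            exI[of _ "s2(r := enc (f a, g a))"]) auto
    qed
    then show "\<exists>c. implements c b i r (\<lambda>e. (f e, g e)) ?Q" ..
  qed
qed

lemma polytime_Cons [polytime_intros]:
  assumes "polytime f" and "polytime g"
  shows "polytime (\<lambda>e. f e # g e)"
proof -
  have "polytime (\<lambda>z :: 'b \<times> 'b list. fst z # snd z)"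
    by (rule polytime_retype) (simp add: enc_prod_def)
  from polytime_comp[OF this polytime_Pair[OF assms]] show ?thesis by simp
qed

text \<open>\<open>False\<close> is encoded as \<open>Leaf\<close> and \<open>True\<close> is not,
  so the machine's test on a stored truth value is the case distinction.\<close>

lemma polytime_if [polytime_intros]:
  assumes "polytime h" and "polytime f" and "polytime g"
  shows "polytime (\<lambda>e. if h e then f e else g e)"
proof -
  obtain p where p: "\<And>a. size (enc (f a)) \<le> poly p (size (enc a))"
    "\<And>b i r. i < b \<Longrightarrow> r < b \<Longrightarrow> \<exists>c. implements c b i r f p"
    using assms(2) by (rule polytimeE) blast
  obtain q where q: "\<And>a. size (enc (g a)) \<le> poly q (size (enc a))"
    "\<And>b i r. i < b \<Longrightarrow> r < b \<Longrightarrow> \<exists>c. implements c b i r g q"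
    using assms(3) by (rule polytimeE) blast
  obtain u where u: "\<And>b i r. i < b \<Longrightarrow> r < b \<Longrightarrow> \<exists>c. implements c b i r h u"
    using assms(1) by (rule polytimeE) blast
  let ?Q = "p + q + u + [:1:]"
  let ?f = "\<lambda>e. if h e then f e else g e"
  show ?thesis
  proof (rule polytimeI[where q = ?Q])
    show "size (enc (?f a)) \<le> poly ?Q (size (enc a))" for a
      using p(1)[of a] q(1)[of a] by simp
  next
    fix b i r :: nat
    assume less: "i < b" "r < b"
    obtain c0 where c0: "implements c0 (b + 1) i b h u" using u[of i "b + 1" b] less by auto
    obtain c1 where c1: "implements c1 b i r f p" using p(2) less by blast
    obtain c2 where c2: "implements c2 b i r g q" using q(2) less by blast
    let ?c = "Seq c0 (Cond b c1 c2)"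
    have "implements ?c b i r ?f ?Q"
    proof (rule implementsI)
      fix s :: store and a :: 'a
      assume a: "s i = enc a"
      with c0 obtain t0 s0 where 0: "exec c0 s t0 s0" "t0 \<le> poly u (size (enc a))"
        "s0 b = enc (h a)" "\<And>v. v < b + 1 \<Longrightarrow> v \<noteq> b \<Longrightarrow> s0 v = s v"
        by (rule implementsE) blast
      have s0: "s0 i = enc a" using a 0(4) less by simp
      show "\<exists>t s'. exec ?c s t s' \<and> t \<le> poly ?Q (size (enc a)) \<and> s' r = enc (?f a) \<and>
          (\<forall>v<b. v \<noteq> r \<longrightarrow> s' v = s v)"
      proof (cases "h a")
        case True
        from c1 s0 obtain t1 s1 where 1: "exec c1 s0 t1 s1" "t1 \<le> poly p (size (enc a))"
          "s1 r = enc (f a)" "\<And>v. v < b \<Longrightarrow> v \<noteq> r \<Longrightarrow> s1 v = s0 v"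
          by (rule implementsE) blast
        have "s0 b \<noteq> Leaf" using 0(3) True by simp
        from exec.Seq[OF 0(1) exec.Cond_True[of s0, OF this 1(1)]] 0 1 True show ?thesis
          by (intro exI[of _ "t0 + (1 + t1)"] exI[of _ s1]) auto
      next
        case False
        from c2 s0 obtain t1 s1 where 1: "exec c2 s0 t1 s1" "t1 \<le> poly q (size (enc a))"
          "s1 r = enc (g a)" "\<And>v. v < b \<Longrightarrow> v \<noteq> r \<Longrightarrow> s1 v = s0 v"
          by (rule implementsE) blast
        have "s0 b = Leaf" using 0(3) False by simp
        from exec.Seq[OF 0(1) exec.Cond_False[of s0, OF this 1(1)]] 0 1 False show ?thesis
          by (intro exI[of _ "t0 + (1 + t1)"] exI[of _ s1]) auto
      qed
    qed
    then show "\<exists>c. implements c b i r ?f ?Q" ..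
  qed
qed

lemma polytime_null [polytime_intros]:
  fixes f :: "'a::enc \<Rightarrow> 'b::enc list"
  assumes "polytime f"
  shows "polytime (\<lambda>e. f e = [])"
proof -
  have "polytime (\<lambda>xs :: 'b list. xs = [])"
  proof (rule polytimeI[where q = "[:4:]"])
    fix b i r :: nat
    assume less: "i < b" "r < b"
    let ?c = "Cond i (Assign r Const_Leaf) (Seq (Assign r Const_Leaf) (Assign r (Join r r)))"
    have "implements ?c b i r (\<lambda>xs :: 'b list. xs = []) [:4:]"
    proof (rule implementsI)
      fix s :: store and a :: "'b list"
      assume a: "s i = enc a"
      show "\<exists>t s'. exec ?c s t s' \<and> t \<le> poly [:4:] (size (enc a)) \<and> s' r = enc (a = []) \<and>
          (\<forall>v<b. v \<noteq> r \<longrightarrow> s' v = s v)"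
      proof (cases a)
        case Nil
        with a have "s i = Leaf" by simp
        from exec.Cond_False[of s, OF this
            exec.Seq[OF exec.Assign[of r Const_Leaf s] exec.Assign[of r "Join r r"]]]
        show ?thesis using Nil by fastforce
      next
        case (Cons x xs)
        with a have "s i \<noteq> Leaf" by simp
        from exec.Cond_True[of s, OF this exec.Assign[of r Const_Leaf s]]
        show ?thesis using Cons by fastforce
      qed
    qed
    then show "\<exists>c. implements c b i r (\<lambda>xs :: 'b list. xs = []) [:4:]" ..
  qed (simp add: enc_bool_def bool_tree_def)
  from polytime_comp[OF this assms] show ?thesis .
qed

text \<open>A nonempty list has the same tree as the pair of its head and tail, so a single
  \<open>Join\<close> with the input produces the encoded triple on which the second branch
  runs.\<close>

lemma polytime_case_list [polytime_intros]:
  fixes xs :: "'a::enc \<Rightarrow> 'b::enc list"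
  assumes "polytime xs" and "polytime f"
    and "polytime (\<lambda>z. g (fst z) (fst (snd z)) (snd (snd z)))"
  shows "polytime (\<lambda>e. case xs e of [] \<Rightarrow> f e | y # ys \<Rightarrow> g e y ys)"
proof -
  let ?g = "\<lambda>z. g (fst z) (fst (snd z)) (snd (snd z))"
  obtain u where u: "\<And>a. size (enc (xs a)) \<le> poly u (size (enc a))"
    "\<And>b i r. i < b \<Longrightarrow> r < b \<Longrightarrow> \<exists>c. implements c b i r xs u"
    using assms(1) by (rule polytimeE) blast
  obtain p where p: "\<And>a. size (enc (f a)) \<le> poly p (size (enc a))"
    "\<And>b i r. i < b \<Longrightarrow> r < b \<Longrightarrow> \<exists>c. implements c b i r f p"
    using assms(2) by (rule polytimeE) blast
  obtain q where q: "\<And>a. size (enc (?g a)) \<le> poly q (size (enc a))"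
    "\<And>b i r. i < b \<Longrightarrow> r < b \<Longrightarrow> \<exists>c. implements c b i r ?g q"
    using assms(3) by (rule polytimeE) blast
  let ?m = "[:1, 1:] + u"
  let ?Q = "p + u + pcompose q ?m + smult 4 ?m + [:10:]"
  let ?f = "\<lambda>e. case xs e of [] \<Rightarrow> f e | y # ys \<Rightarrow> g e y ys"
  have m: "size (enc (a, y, ys)) \<le> poly ?m (size (enc a))" if "xs a = y # ys" for a y ys
    using u(1)[of a] that by simp
  have mono: "poly q (size (enc (a, y, ys))) \<le> poly (pcompose q ?m) (size (enc a))"
    if "xs a = y # ys" for a y ys
    using poly_nat_mono[OF m[OF that]] by (simp add: poly_pcompose)
  show ?thesis
  proof (rule polytimeI[where q = ?Q])
    fix a
    show "size (enc (?f a)) \<le> poly ?Q (size (enc a))"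
    proof (cases "xs a")
      case Nil
      then show ?thesis using p(1)[of a] by simp
    next
      case (Cons y ys)
      then show ?thesis using q(1)[of "(a, y, ys)"] mono[OF Cons] by simp
    qed
  next
    fix b i r :: nat
    assume less: "i < b" "r < b"
    obtain c0 where c0: "implements c0 (b + 1) i b xs u" using u(2)[of i "b + 1" b] less by auto
    obtain c1 where c1: "implements c1 b i r f p" using p(2) less by blast
    obtain c2 where c2: "implements c2 (b + 1) b r ?g q" using q(2)[of b "b + 1" r] less by auto
    let ?c = "Seq c0 (Cond b (Seq (Assign b (Join i b)) c2) c1)"
    have "implements ?c b i r ?f ?Q"
    proof (rule implementsI)
      fix s :: store and a :: 'a
      assume a: "s i = enc a"
      with c0 obtain t0 s0 where 0: "exec c0 s t0 s0" "t0 \<le> poly u (size (enc a))"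
        "s0 b = enc (xs a)" "\<And>v. v < b + 1 \<Longrightarrow> v \<noteq> b \<Longrightarrow> s0 v = s v"
        by (rule implementsE) blast
      have s0: "s0 i = enc a" using a 0(4) less by simp
      show "\<exists>t s'. exec ?c s t s' \<and> t \<le> poly ?Q (size (enc a)) \<and> s' r = enc (?f a) \<and>
          (\<forall>v<b. v \<noteq> r \<longrightarrow> s' v = s v)"
      proof (cases "xs a")
        case Nil
        from c1 s0 obtain t1 s1 where 1: "exec c1 s0 t1 s1" "t1 \<le> poly p (size (enc a))"
          "s1 r = enc (f a)" "\<And>v. v < b \<Longrightarrow> v \<noteq> r \<Longrightarrow> s1 v = s0 v"
          by (rule implementsE) blast
        have "s0 b = Leaf" using 0(3) Nil by simp
        from exec.Seq[OF 0(1) exec.Cond_False[of s0, OF this 1(1)]] 0 1 Nil show ?thesis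
          by (intro exI[of _ "t0 + (1 + t1)"] exI[of _ s1]) auto
      next
        case (Cons y ys)
        let ?s = "s0(b := enc (a, y, ys))"
        have step: "exec (Assign b (Join i b)) s0 (1 + size (enc (a, y, ys))) ?s"
          using exec.Assign[of b "Join i b" s0] s0 0(3) Cons by simp
        have "?s b = enc (a, y, ys)" by simp
        with c2 obtain t1 s1 where 1: "exec c2 ?s t1 s1" "t1 \<le> poly q (size (enc (a, y, ys)))"
          "s1 r = enc (?g (a, y, ys))" "\<And>v. v < b + 1 \<Longrightarrow> v \<noteq> r \<Longrightarrow> s1 v = ?s v"
          by (rule implementsE) blast
        have "s0 b \<noteq> Leaf" using 0(3) Cons by simp
        from exec.Seq[OF 0(1) exec.Cond_True[of s0, OF this exec.Seq[OF step 1(1)]]] 0 1 Cons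
          m[OF Cons] mono[OF Cons]
        show ?thesis
          by (intro exI[of _ "t0 + (1 + (1 + size (enc (a, y, ys)) + t1))"] exI[of _ s1]) auto
      qed
    qed
    then show "\<exists>c. implements c b i r ?f ?Q" ..
  qed
qed

section \<open>Iteration over lists by folds\<close>

lemma size_enc_append: "size (enc (xs @ ys)) = size (enc xs) + size (enc ys)"
  by (induction xs) auto

lemma length_le_size_enc: "length xs \<le> size (enc xs)"
  by (induction xs) auto

text \<open>The loop keeps the remaining list in register \<open>b\<close>, the accumulator in
  \<open>b + 1\<close> and the argument of the step in \<open>b + 2\<close>. The hypothesis
  \<open>bound\<close> excludes polynomial-time steps that, for instance, double the accumulator and
  make it exponentially large.\<close>

lemma polytime_foldl:
  fixes xs :: "'a::enc \<Rightarrow> 'b::enc list" and w :: "'a \<Rightarrow> 'c::enc"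
  assumes "polytime (\<lambda>z. g (fst z) (snd (snd z)) (fst (snd z)))"
    and "polytime w" and "polytime xs"
    and bound: "\<And>e l. size (enc (foldl (g e) (w e) l)) \<le> poly B (size (enc e) + size (enc l))"
  shows "polytime (\<lambda>e. foldl (g e) (w e) (xs e))"
proof -
  let ?g = "\<lambda>z :: 'a \<times> 'b \<times> 'c. g (fst z) (snd (snd z)) (fst (snd z))"
  obtain u where u: "\<And>a. size (enc (xs a)) \<le> poly u (size (enc a))"
    "\<And>b i r. i < b \<Longrightarrow> r < b \<Longrightarrow> \<exists>c. implements c b i r xs u"
    using assms(3) by (rule polytimeE) blast
  obtain p where p: "\<And>a. size (enc (w a)) \<le> poly p (size (enc a))"
    "\<And>b i r. i < b \<Longrightarrow> r < b \<Longrightarrow> \<exists>c. implements c b i r w p"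
    using assms(2) by (rule polytimeE) blast
  obtain q where q: "\<And>b i r. i < b \<Longrightarrow> r < b \<Longrightarrow> \<exists>c. implements c b i r ?g q"
    using assms(1) by (rule polytimeE) blast
  \<comment> \<open>\<open>?A\<close> bounds every accumulator, \<open>?m\<close> all data handled
    in one round and \<open>?K\<close> the time of a round. The number of rounds is the list length,
    hence at most \<open>u\<close>.\<close>
  let ?A = "pcompose B ([:0, 1:] + u)"
  let ?m = "[:2, 1:] + u + ?A"
  let ?K = "[:5:] + smult 4 ?m + pcompose q ?m"
  let ?Q = "u + p + u * ?K + [:2:] + ?A"
  let ?f = "\<lambda>e. foldl (g e) (w e) (xs e)"
  \<comment> \<open>Prefixes of the list have no larger codes, so this covers all intermediate
    accumulators.\<close>
  have acc: "size (enc (foldl (g e) (w e) l)) \<le> poly ?A (size (enc e))"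
    if "size (enc l) \<le> size (enc (xs e))" for e l
  proof -
    have "size (enc e) + size (enc l) \<le> size (enc e) + poly u (size (enc e))"
      using u(1)[of e] that by linarith
    from order_trans[OF bound poly_nat_mono[OF this]] show ?thesis
      by (simp add: poly_pcompose)
  qed
  show ?thesis
  proof (rule polytimeI[where q = ?Q])
    show "size (enc (?f e)) \<le> poly ?Q (size (enc e))" for e
      using acc[of "xs e" e] by simp
  next
    fix b i r :: nat
    assume less: "i < b" "r < b"
    obtain c0 where c0: "implements c0 (b + 1) i b xs u" using u(2)[of i "b + 1" b] less by auto
    obtain c1 where c1: "implements c1 (b + 2) i (b + 1) w p"
      using p(2)[of i "b + 2" "b + 1"] less by auto
    obtain c2 where c2: "implements c2 (b + 3) (b + 2) (b + 1) ?g q"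
      using q[of "b + 2" "b + 3" "b + 1"] by auto
    let ?body = "Seq (Assign (b + 2) (Head b)) (Seq (Assign (b + 2) (Join (b + 2) (b + 1)))
      (Seq (Assign (b + 2) (Join i (b + 2))) (Seq c2 (Assign b (Tail b)))))"
    let ?loop = "While b ?body"
    \<comment> \<open>Loop invariant: \<open>l0\<close> is the part already processed,
      \<open>l\<close> the part that remains.\<close>
    have loop: "\<exists>t s'. exec ?loop s t s' \<and> t \<le> length l * poly ?K (size (enc e)) + 1 \<and>
        s' (b + 1) = enc (?f e) \<and> (\<forall>v<b. s' v = s v)"
      if "s i = enc e" "s b = enc l" "xs e = l0 @ l" "s (b + 1) = enc (foldl (g e) (w e) l0)"
      for s e l0 l
      using that
    proof (induction l arbitrary: s l0)
      case Nil
      then show ?case using exec.While_False[of s b ?body] by auto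
    next
      case (Cons y l)
      let ?acc = "foldl (g e) (w e) l0"
      let ?s1 = "s(b + 2 := enc y)"
      let ?s2 = "?s1(b + 2 := enc (y, ?acc))"
      let ?s3 = "?s2(b + 2 := enc (e, y, ?acc))"
      have sz: "size (enc e) + size (enc y) + size (enc l) + size (enc ?acc) + 2
          \<le> poly ?m (size (enc e))"
        using acc[of l0 e] u(1)[of e] Cons.prems(3) by (simp add: size_enc_append)
      have e1: "exec (Assign (b + 2) (Head b)) s (1 + size (enc y)) ?s1"
        using exec.Assign[of "b + 2" "Head b" s] Cons.prems(2) by simp
      have e2: "exec (Assign (b + 2) (Join (b + 2) (b + 1))) ?s1 (1 + size (enc (y, ?acc))) ?s2"
        using exec.Assign[of "b + 2" "Join (b + 2) (b + 1)" ?s1] Cons.prems(4) by simp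
      have e3: "exec (Assign (b + 2) (Join i (b + 2))) ?s2 (1 + size (enc (e, y, ?acc))) ?s3"
        using exec.Assign[of "b + 2" "Join i (b + 2)" ?s2] Cons.prems(1) less by simp
      have "?s3 (b + 2) = enc (e, y, ?acc)" by simp
      with c2 obtain t4 s4 where 4: "exec c2 ?s3 t4 s4" "t4 \<le> poly q (size (enc (e, y, ?acc)))"
        "s4 (b + 1) = enc (?g (e, y, ?acc))" "\<And>v. v < b + 3 \<Longrightarrow> v \<noteq> b + 1 \<Longrightarrow> s4 v = ?s3 v"
        by (rule implementsE) blast
      let ?s5 = "s4(b := enc l)"
      have e5: "exec (Assign b (Tail b)) s4 (1 + size (enc l)) ?s5"
        using exec.Assign[of b "Tail b" s4] 4(4)[of b] Cons.prems(2) by simp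
      have "\<exists>t s'. exec ?loop ?s5 t s' \<and> t \<le> length l * poly ?K (size (enc e)) + 1 \<and>
          s' (b + 1) = enc (?f e) \<and> (\<forall>v<b. s' v = ?s5 v)"
      proof (rule Cons.IH[where ?l0.0 = "l0 @ [y]"])
        show "?s5 i = enc e" using 4(4)[of i] less Cons.prems(1) by simp
        show "?s5 b = enc l" by simp
        show "xs e = (l0 @ [y]) @ l" using Cons.prems(3) by simp
        show "?s5 (b + 1) = enc (foldl (g e) (w e) (l0 @ [y]))" using 4(3) by simp
      qed
      then obtain t s' where ih: "exec ?loop ?s5 t s'" "t \<le> length l * poly ?K (size (enc e)) + 1"
        "s' (b + 1) = enc (?f e)" "\<forall>v<b. s' v = ?s5 v" by blast
      have "s b \<noteq> Leaf" using Cons.prems(2) by simp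
      note ex = exec.While_True[of s b, OF this
          exec.Seq[OF e1 exec.Seq[OF e2 exec.Seq[OF e3 exec.Seq[OF 4(1) e5]]]] ih(1)]
      have "poly q (size (enc (e, y, ?acc))) \<le> poly q (poly ?m (size (enc e)))"
        by (rule poly_nat_mono) (use sz in simp)
      then have t4: "t4 \<le> poly (pcompose q ?m) (size (enc e))"
        using 4(2) by (simp add: poly_pcompose)
      have "1 + (1 + size (enc y) + (1 + size (enc (y, ?acc)) + (1 + size (enc (e, y, ?acc)) +
          (t4 + (1 + size (enc l)))))) + t \<le> length (y # l) * poly ?K (size (enc e)) + 1"
        using sz t4 ih(2) by simp
      moreover have "\<forall>v<b. s' v = s v" using ih(4) 4(4) by auto
      ultimately show ?case using ex ih(3) by blast
    qed
    let ?c = "Seq c0 (Seq c1 (Seq ?loop (Assign r (Copy (b + 1)))))"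
    have "implements ?c b i r ?f ?Q"
    proof (rule implementsI)
      fix s :: store and a :: 'a
      assume a: "s i = enc a"
      with c0 obtain t0 s0 where 0: "exec c0 s t0 s0" "t0 \<le> poly u (size (enc a))"
        "s0 b = enc (xs a)" "\<And>v. v < b + 1 \<Longrightarrow> v \<noteq> b \<Longrightarrow> s0 v = s v"
        by (rule implementsE) blast
      have "s0 i = enc a" using a 0(4) less by simp
      with c1 obtain t1 s1 where 1: "exec c1 s0 t1 s1" "t1 \<le> poly p (size (enc a))"
        "s1 (b + 1) = enc (w a)" "\<And>v. v < b + 2 \<Longrightarrow> v \<noteq> b + 1 \<Longrightarrow> s1 v = s0 v"
        by (rule implementsE) blast
      have "\<exists>t s'. exec ?loop s1 t s' \<and> t \<le> length (xs a) * poly ?K (size (enc a)) + 1 \<and>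
          s' (b + 1) = enc (?f a) \<and> (\<forall>v<b. s' v = s1 v)"
        by (rule loop[where ?l0.0 = "[]"]) (use 0 1 a less in auto)
      then obtain t2 s2 where 2: "exec ?loop s1 t2 s2"
        "t2 \<le> length (xs a) * poly ?K (size (enc a)) + 1"
        "s2 (b + 1) = enc (?f a)" "\<forall>v<b. s2 v = s1 v" by blast
      have "length (xs a) * poly ?K (size (enc a)) \<le> poly u (size (enc a)) * poly ?K (size (enc a))"
        using order_trans[OF length_le_size_enc u(1)] by (rule mult_right_mono) simp
      with 2(2) have "t2 \<le> poly (u * ?K) (size (enc a)) + 1"
        by (simp only: poly_mult)
      then have "t0 + (t1 + (t2 + (1 + size (enc (?f a))))) \<le> poly ?Q (size (enc a))"
        using 0(2) 1(2) acc[of "xs a" a] unfolding poly_add by simp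
      moreover have "exec ?c s (t0 + (t1 + (t2 + (1 + size (enc (?f a)))))) (s2(r := enc (?f a)))"
        using exec.Seq[OF 0(1) exec.Seq[OF 1(1) exec.Seq[OF 2(1)
              exec.Assign[of r "Copy (b + 1)" s2]]]] 2(3) by simp
      moreover have "\<forall>v<b. v \<noteq> r \<longrightarrow> (s2(r := enc (?f a))) v = s v"
        using 0(4) 1(4) 2(4) by simp
      ultimately show "\<exists>t s'. exec ?c s t s' \<and> t \<le> poly ?Q (size (enc a)) \<and> s' r = enc (?f a) \<and>
          (\<forall>v<b. v \<noteq> r \<longrightarrow> s' v = s v)" by (metis fun_upd_same)
    qed
    then show "\<exists>c. implements c b i r ?f ?Q" ..
  qed
qed

text \<open>If the amount added in a step is bounded independently of the accumulator, the total
  growth is at most the number of rounds times that amount, hence polynomial.\<close>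

lemma polytime_foldl_additive:
  fixes xs :: "'a::enc \<Rightarrow> 'b::enc list" and w :: "'a \<Rightarrow> 'c::enc"
  assumes "polytime (\<lambda>z. g (fst z) (snd (snd z)) (fst (snd z)))"
    and "polytime w" and "polytime xs"
    and growth: "\<And>e acc x. size (enc (g e acc x)) \<le> size (enc acc) + poly R (size (enc e) + size (enc x))"
  shows "polytime (\<lambda>e. foldl (g e) (w e) (xs e))"
proof -
  obtain p where p: "\<And>a. size (enc (w a)) \<le> poly p (size (enc a))"
    using assms(2) by (rule polytimeE) blast
  have aux: "size (enc (foldl (g e) a l)) \<le> size (enc a) + length l * poly R (size (enc e) + size (enc l))"
    for e a l
  proof (induction l rule: rev_induct)
    case (snoc x l)
    have "poly R (size (enc e) + size (enc x)) \<le> poly R (size (enc e) + size (enc (l @ [x])))"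
      and "poly R (size (enc e) + size (enc l)) \<le> poly R (size (enc e) + size (enc (l @ [x])))"
      by (intro poly_nat_mono; simp add: size_enc_append)+
    from this(1) mult_le_mono2[OF this(2), of "length l"] have "size (enc (g e (foldl (g e) a l) x))
        \<le> size (enc a) + (length l * poly R (size (enc e) + size (enc (l @ [x])))
          + poly R (size (enc e) + size (enc (l @ [x]))))"
      using growth[of e "foldl (g e) a l" x] snoc by linarith
    then show ?case by (simp add: algebra_simps)
  qed simp
  show ?thesis
  proof (rule polytime_foldl[OF assms(1-3), where B = "p + [:0, 1:] * R"])
    fix e :: 'a and l :: "'b list"
    have "poly p (size (enc e)) \<le> poly p (size (enc e) + size (enc l))"
      by (rule poly_nat_mono) simp
    moreover have "length l * poly R (size (enc e) + size (enc l))
        \<le> (size (enc e) + size (enc l)) * poly R (size (enc e) + size (enc l))"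
      using length_le_size_enc[of l] by (intro mult_right_mono) auto
    ultimately have "size (enc (foldl (g e) (w e) l)) \<le> poly p (size (enc e) + size (enc l)) +
        (size (enc e) + size (enc l)) * poly R (size (enc e) + size (enc l))"
      using aux[of e "w e" l] p[of e] by linarith
    then show "size (enc (foldl (g e) (w e) l)) \<le> poly (p + [:0, 1:] * R) (size (enc e) + size (enc l))"
      by simp
  qed
qed

lemma size_enc_bool: "size (enc (b :: bool)) \<le> 1"
  by (cases b) auto

lemma polytime_size_bound:
  assumes "polytime (\<lambda>z. g (fst z) (snd z))"
  obtains q where "\<And>e x. size (enc (g e x)) \<le> poly q (size (enc e) + size (enc x))"
proof -
  obtain q where q: "\<And>z. size (enc (g (fst z) (snd z))) \<le> poly q (size (enc z))"
    using assms by (rule polytimeE) blast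
  have "size (enc (g e x)) \<le> poly (pcompose q [:1, 1:]) (size (enc e) + size (enc x))" for e x
    using q[of "(e, x)"] by (simp add: poly_pcompose)
  then show ?thesis by (rule that)
qed

section \<open>Polynomial-time list operations and comparisons\<close>

lemma polytime_rev [polytime_intros]:
  assumes "polytime xs"
  shows "polytime (\<lambda>e. rev (xs e))"
proof -
  have "polytime (\<lambda>e. foldl (\<lambda>acc x. x # acc) [] (xs e))"
    by (rule polytime_foldl_additive[where g = "\<lambda>e acc x. x # acc" and R = "[:1, 1:]"])
      (intro polytime_intros assms | simp)+
  moreover have "foldl (\<lambda>acc x. x # acc) ys l = rev l @ ys" for ys l :: "'b list"
    by (induction l arbitrary: ys) auto
  ultimately show ?thesis by simp
qed

lemma polytime_append [polytime_intros]:
  assumes "polytime xs" and "polytime ys"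
  shows "polytime (\<lambda>e. xs e @ ys e)"
proof -
  have "polytime (\<lambda>e. foldl (\<lambda>acc x. x # acc) (ys e) (rev (xs e)))"
    by (rule polytime_foldl_additive[where g = "\<lambda>e acc x. x # acc" and R = "[:1, 1:]"])
      (intro polytime_intros assms | simp)+
  moreover have "foldl (\<lambda>acc x. x # acc) ys l = rev l @ ys" for ys l :: "'b list"
    by (induction l arbitrary: ys) auto
  ultimately show ?thesis by simp
qed

lemma polytime_concat [polytime_intros]:
  assumes "polytime xs"
  shows "polytime (\<lambda>e. concat (xs e))"
proof -
  have "polytime (\<lambda>e. foldl (\<lambda>acc x. acc @ x) [] (xs e))"
    by (rule polytime_foldl_additive[where g = "\<lambda>e acc x. acc @ x" and R = "[:1, 1:]"])
      (intro polytime_intros assms | simp add: size_enc_append)+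
  moreover have "foldl (\<lambda>acc x. acc @ x) ys l = ys @ concat l" for ys and l :: "'b list list"
    by (induction l arbitrary: ys) auto
  ultimately show ?thesis by simp
qed

lemma polytime_map [polytime_intros]:
  fixes xs :: "'a::enc \<Rightarrow> 'b::enc list" and g :: "'a \<Rightarrow> 'b \<Rightarrow> 'c::enc"
  assumes g: "polytime (\<lambda>z. g (fst z) (snd z))" and "polytime xs"
  shows "polytime (\<lambda>e. map (g e) (xs e))"
proof -
  obtain q where q: "\<And>e x. size (enc (g e x)) \<le> poly q (size (enc e) + size (enc x))"
    using polytime_size_bound[OF g] by blast
  have "polytime (\<lambda>e. foldl (\<lambda>acc x. g e x # acc) [] (xs e))"
  proof (rule polytime_foldl_additive[where g = "\<lambda>e acc x. g e x # acc" and R = "q + [:1:]"])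
    show "polytime (\<lambda>z :: 'a \<times> 'b \<times> 'c list. g (fst z) (fst (snd z)) # snd (snd z))"
    proof (rule polytime_Cons)
      have "polytime (\<lambda>z :: 'a \<times> 'b \<times> 'c list. (fst z, fst (snd z)))"
        by (intro polytime_intros)
      from polytime_comp[OF g this]
      show "polytime (\<lambda>z :: 'a \<times> 'b \<times> 'c list. g (fst z) (fst (snd z)))" by simp
    qed (intro polytime_intros)
    show "size (enc (g e x # acc)) \<le> size (enc acc) + poly (q + [:1:]) (size (enc e) + size (enc x))"
      for e x acc using q[of e x] by simp
  qed (intro polytime_intros assms)+
  then have "polytime (\<lambda>e. rev (foldl (\<lambda>acc x. g e x # acc) [] (xs e)))"
    by (rule polytime_rev)
  moreover have "foldl (\<lambda>acc x. g e x # acc) ys l = rev (map (g e) l) @ ys" for ys l e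
    by (induction l arbitrary: ys) auto
  ultimately show ?thesis by simp
qed

lemma polytime_filter [polytime_intros]:
  fixes xs :: "'a::enc \<Rightarrow> 'b::enc list"
  assumes "polytime (\<lambda>z. P (fst z) (snd z))" and "polytime xs"
  shows "polytime (\<lambda>e. filter (P e) (xs e))"
proof -
  have "polytime (\<lambda>e. concat (map (\<lambda>x. if P e x then [x] else []) (xs e)))"
    by (intro polytime_intros assms)
  moreover have "concat (map (\<lambda>x. if P e x then [x] else []) l) = filter (P e) l" for e l
    by (induction l) auto
  ultimately show ?thesis by simp
qed

lemma polytime_bex [polytime_intros]:
  fixes xs :: "'a::enc \<Rightarrow> 'b::enc list"
  assumes "polytime (\<lambda>z. P (fst z) (snd z))" and "polytime xs"
  shows "polytime (\<lambda>e. \<exists>x\<in>set (xs e). P e x)"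
proof -
  have "polytime (\<lambda>e. if filter (P e) (xs e) = [] then False else True)"
    by (intro polytime_intros assms)
  moreover have "(if filter (P e) l = [] then False else True) = (\<exists>x\<in>set l. P e x)" for e l
    by (auto simp: filter_empty_conv)
  ultimately show ?thesis by simp
qed

lemma polytime_not [polytime_intros]:
  assumes "polytime f"
  shows "polytime (\<lambda>e. \<not> f e)"
proof -
  have "polytime (\<lambda>e. if f e then False else True)" by (intro polytime_intros assms)
  moreover have "(\<lambda>e. if f e then False else True) = (\<lambda>e. \<not> f e)" by auto
  ultimately show ?thesis by simp
qed

lemma polytime_conj [polytime_intros]:
  assumes "polytime f" and "polytime g"
  shows "polytime (\<lambda>e. f e \<and> g e)"
proof -
  have "polytime (\<lambda>e. if f e then g e else False)" by (intro polytime_intros assms)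
  moreover have "(\<lambda>e. if f e then g e else False) = (\<lambda>e. f e \<and> g e)" by auto
  ultimately show ?thesis by simp
qed

lemma polytime_disj [polytime_intros]:
  assumes "polytime f" and "polytime g"
  shows "polytime (\<lambda>e. f e \<or> g e)"
proof -
  have "polytime (\<lambda>e. if f e then True else g e)" by (intro polytime_intros assms)
  moreover have "(\<lambda>e. if f e then True else g e) = (\<lambda>e. f e \<or> g e)" by auto
  ultimately show ?thesis by simp
qed

lemma polytime_eq_bool [polytime_intros]:
  fixes f :: "'a::enc \<Rightarrow> bool"
  assumes "polytime f" and "polytime g"
  shows "polytime (\<lambda>e. f e = g e)"
proof -
  have "polytime (\<lambda>e. if f e then g e else \<not> g e)" by (intro polytime_intros assms)
  moreover have "(\<lambda>e. if f e then g e else \<not> g e) = (\<lambda>e. f e = g e)" by auto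
  ultimately show ?thesis by simp
qed

lemma polytime_ball [polytime_intros]:
  fixes xs :: "'a::enc \<Rightarrow> 'b::enc list"
  assumes "polytime (\<lambda>z. P (fst z) (snd z))" and "polytime xs"
  shows "polytime (\<lambda>e. \<forall>x\<in>set (xs e). P e x)"
proof -
  have "polytime (\<lambda>e. \<not> (\<exists>x\<in>set (xs e). \<not> P e x))"
    by (intro polytime_intros assms)
  then show ?thesis by simp
qed

lemma polytime_tl [polytime_intros]:
  fixes xs :: "'a::enc \<Rightarrow> 'b::enc list"
  assumes "polytime xs"
  shows "polytime (\<lambda>e. tl (xs e))"
proof -
  have "polytime (\<lambda>e. case xs e of [] \<Rightarrow> [] | y # ys \<Rightarrow> ys)"
    by (intro polytime_intros assms)
  then show ?thesis by (simp add: tl_def)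
qed

lemma size_enc_tl_le: "size (enc (tl xs)) \<le> size (enc xs)"
  by (cases xs) auto

lemma foldl_tl: "foldl (\<lambda>acc x. tl acc) ys xs = drop (length xs) ys"
  by (induction xs arbitrary: ys) (auto simp: drop_Suc)

text \<open>Removing one element of \<open>xs\<close> for each element of \<open>ys\<close> compares
  lengths without arithmetic.\<close>

lemma polytime_drop_length:
  fixes xs :: "'a::enc \<Rightarrow> 'b::enc list" and ys :: "'a::enc \<Rightarrow> 'c::enc list"
  assumes "polytime xs" and "polytime ys"
  shows "polytime (\<lambda>e. drop (length (ys e)) (xs e))"
proof -
  have "polytime (\<lambda>e. foldl (\<lambda>acc x. tl acc) (xs e) (ys e))"
    by (rule polytime_foldl_additive[where g = "\<lambda>e acc x. tl acc" and R = 0])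
      (intro polytime_intros assms | simp add: size_enc_tl_le)+
  then show ?thesis by (simp add: foldl_tl)
qed

lemma foldl_zip:
  "snd (foldl (\<lambda>acc x. case fst acc of [] \<Rightarrow> acc | y # ys \<Rightarrow> (ys, (x, y) # snd acc)) (ys, zs) xs)
    = rev (zip xs ys) @ zs"
proof (induction xs arbitrary: ys zs)
  case (Cons x xs)
  have "foldl (\<lambda>acc x. case fst acc of [] \<Rightarrow> acc | y # ys \<Rightarrow> (ys, (x, y) # snd acc)) ([], zs) l = ([], zs)"
    for l :: "'a list" and zs :: "('a \<times> 'b) list"
    by (induction l) auto
  then show ?case by (cases ys) (simp_all add: Cons.IH)
qed simp

text \<open>The accumulator pairs the unread part of the second list with the reversed
  output.\<close>

lemma polytime_zip [polytime_intros]: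
  fixes xs :: "'a::enc \<Rightarrow> 'b::enc list" and ys :: "'a::enc \<Rightarrow> 'c::enc list"
  assumes "polytime xs" and "polytime ys"
  shows "polytime (\<lambda>e. zip (xs e) (ys e))"
proof -
  let ?g = "\<lambda>(acc :: 'c list \<times> ('b \<times> 'c) list) x.
    case fst acc of [] \<Rightarrow> acc | y # ys \<Rightarrow> (ys, (x, y) # snd acc)"
  have "polytime (\<lambda>e. foldl ?g (ys e, []) (xs e))"
  proof (rule polytime_foldl_additive[where g = "\<lambda>e. ?g" and R = "[:2, 1:]"])
    show "size (enc (?g acc x)) \<le> size (enc acc) + poly [:2, 1:] (size (enc e) + size (enc x))"
      for acc x and e :: 'a
      by (cases acc; cases "fst acc") auto
  qed (intro polytime_intros assms)+
  then have "polytime (\<lambda>e. rev (snd (foldl ?g (ys e, []) (xs e))))"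
    by (intro polytime_intros)
  then show ?thesis by (simp add: foldl_zip)
qed

text \<open>Two lists have equal length iff dropping the length of either from the other leaves
  nothing; the entries are then compared through \<open>zip\<close>.\<close>

lemma polytime_eq_list:
  fixes xs :: "'a::enc \<Rightarrow> 'b::enc list"
  assumes "polytime (\<lambda>z :: 'b \<times> 'b. fst z = snd z)" and "polytime xs" and "polytime ys"
  shows "polytime (\<lambda>e. xs e = ys e)"
proof -
  have eq: "polytime (\<lambda>z :: 'a \<times> 'b \<times> 'b. fst (snd z) = snd (snd z))"
    by (rule polytime_comp[OF assms(1)]) (intro polytime_intros)
  have "polytime (\<lambda>e. drop (length (ys e)) (xs e) = [] \<and> drop (length (xs e)) (ys e) = [] \<and>
      (\<forall>p\<in>set (zip (xs e) (ys e)). fst p = snd p))"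
    by (intro polytime_intros polytime_drop_length assms eq)
  moreover have "drop (length v) u = [] \<and> drop (length u) v = [] \<and> (\<forall>p\<in>set (zip u v). fst p = snd p)
      \<longleftrightarrow> u = v" for u v :: "'b list"
    unfolding list.rel_eq[symmetric] list_all2_iff by (auto simp: split_beta)
  ultimately show ?thesis by simp
qed

text \<open>Numbers are equal iff their bit lists are, and these are obtained at the cost of a
  copy.\<close>

lemma polytime_eq_nat [polytime_intros]:
  fixes f :: "'a::enc \<Rightarrow> nat"
  assumes "polytime f" and "polytime g"
  shows "polytime (\<lambda>e. f e = g e)"
proof -
  have bits: "polytime nat_bits"
    by (rule polytime_retype) (rule enc_nat_bits)
  have "polytime (\<lambda>e. nat_bits (f e) = nat_bits (g e))"
    by (rule polytime_eq_list) (intro polytime_intros polytime_comp[OF bits] assms)+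
  moreover have "nat_bits m = nat_bits n \<longleftrightarrow> m = n" for m n
    using nat_bits_inject by blast
  ultimately show ?thesis by simp
qed

lemma polytime_mem [polytime_intros]:
  fixes f :: "'a::enc \<Rightarrow> nat"
  assumes "polytime f" and "polytime xs"
  shows "polytime (\<lambda>e. f e \<in> set (xs e))"
proof -
  have "polytime (\<lambda>e. \<exists>x\<in>set (xs e). f e = x)"
    by (intro polytime_intros polytime_comp[OF assms(1)] assms)
  then show ?thesis by simp
qed

section \<open>The kernelization algorithm\<close>

definition adj :: "(nat \<times> nat) list \<Rightarrow> nat \<Rightarrow> nat \<Rightarrow> bool" where
  "adj es u v \<longleftrightarrow> (\<exists>e\<in>set es. fst e = u \<and> snd e = v \<or> fst e = v \<and> snd e = u)"

definition adj_twins :: "nat list \<Rightarrow> (nat \<times> nat) list \<Rightarrow> nat \<Rightarrow> nat \<Rightarrow> bool" where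
  "adj_twins vs es u v \<longleftrightarrow> (\<forall>w\<in>set vs. (w = u \<or> adj es u w) = (w = v \<or> adj es v w))"

definition cover_step ::
  "nat list \<Rightarrow> (nat \<times> nat) list \<Rightarrow> nat list \<Rightarrow> nat \<times> nat \<Rightarrow> nat list" where
  "cover_step vs es X e =
     (if fst e \<in> set X \<or> snd e \<in> set X \<or> adj_twins vs es (fst e) (snd e) then X
      else fst e # snd e # X)"

definition cover :: "nat list \<Rightarrow> (nat \<times> nat) list \<Rightarrow> nat list" where
  "cover vs es = foldl (cover_step vs es) [] es"

definition rest :: "nat list \<Rightarrow> (nat \<times> nat) list \<Rightarrow> nat list" where
  "rest vs es = filter (\<lambda>v. v \<notin> set (cover vs es)) vs"

text \<open>Ordered tuples without repetition stand for sets of \<open>n\<close> elements. Listing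
  each set in all orders is harmless, since \<open>length X ^ n\<close> still bounds the number of
  tuples.\<close>

primrec dlists :: "nat \<Rightarrow> nat list \<Rightarrow> nat list list" where
  "dlists 0 X = [[]]"
| "dlists (Suc n) X =
     concat (map (\<lambda>S. map (\<lambda>x. x # S) (filter (\<lambda>x. x \<notin> set S) X)) (dlists n X))"

primrec dlists_upto :: "nat \<Rightarrow> nat list \<Rightarrow> nat list list" where
  "dlists_upto 0 X = [[]]"
| "dlists_upto (Suc n) X = dlists (Suc n) X @ dlists_upto n X"

text \<open>For \<open>v\<close> outside the cover and \<open>I\<close> the remaining vertices, this
  is the clique of twins that forms the component of \<open>v\<close> once the cover is
  deleted.\<close>

definition block :: "(nat \<times> nat) list \<Rightarrow> nat list \<Rightarrow> nat \<Rightarrow> nat list" where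
  "block es I v = filter (\<lambda>u. u = v \<or> adj es u v) I"

text \<open>For each size from 1 to \<open>s\<close>, one witness if there is any: that many
  vertices of a single block adjacent to all of \<open>S\<close>, together with \<open>S\<close>.
  The test by \<open>drop\<close> says that the block has at least \<open>Suc s\<close> vertices;
  larger blocks are cut down.\<close>

primrec clique_pieces :: "nat \<Rightarrow> (nat \<times> nat) list \<Rightarrow> nat list \<Rightarrow> nat list \<Rightarrow> nat list list" where
  "clique_pieces 0 es I S = []"
| "clique_pieces (Suc s) es I S =
     (case filter (\<lambda>v. drop s (block es I v) \<noteq> [] \<and> (\<forall>x\<in>set S. adj es v x)) I of
        [] \<Rightarrow> []
      | v # _ \<Rightarrow> [take (Suc s) (block es I v) @ S]) @ clique_pieces s es I S"

section \<open>Selecting a basis of the span of boundaries\<close>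

definition lead :: "bool list \<Rightarrow> bool" where
  "lead v = (case v of [] \<Rightarrow> False | b # _ \<Rightarrow> b)"

definition xor_bits :: "bool list \<Rightarrow> bool list \<Rightarrow> bool list" where
  "xor_bits u v = map (\<lambda>p. fst p \<noteq> snd p) (zip u v)"

text \<open>
  One column of Gaussian elimination over the two-element field. The pivot row is also added to
  itself; the resulting zero row never becomes a pivot again, so it need not be removed.
\<close>

definition pivot_step ::
  "(nat list \<times> bool list) list \<times> nat list list \<Rightarrow> (nat list \<times> bool list) list \<times> nat list list" where
  "pivot_step st = (case filter (\<lambda>r. lead (snd r)) (fst st) of
       [] \<Rightarrow> (map (\<lambda>r. (fst r, tl (snd r))) (fst st), snd st)
     | p # _ \<Rightarrow>
        (map (\<lambda>r. (fst r, if lead (snd r) then xor_bits (tl (snd p)) (tl (snd r)) else tl (snd r))) (fst st),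
         fst p # snd st))"

text \<open>The list \<open>cols\<close> supplies the number of columns, with one elimination step
  for each.\<close>

definition pivot_labels :: "nat list list \<Rightarrow> (nat list \<times> bool list) list \<Rightarrow> nat list list" where
  "pivot_labels cols rows = snd (foldl (\<lambda>st _. pivot_step st) (rows, []) cols)"

text \<open>
  The row of \<open>S\<close> is the boundary of the simplex \<open>S\<close> modulo 2, with the faces listed as ordered
  tuples.
\<close>

definition boundary_rows ::
  "nat \<Rightarrow> (nat \<times> nat) list \<Rightarrow> nat list \<Rightarrow> nat list \<Rightarrow> (nat list \<times> bool list) list" where
  "boundary_rows d es I X = concat (map (\<lambda>S.
     case filter (\<lambda>v. \<forall>x\<in>set S. adj es v x) I of
       [] \<Rightarrow> []
     | v # _ \<Rightarrow> [(v # S, map (\<lambda>T. \<forall>x\<in>set T. x \<in> set S) (dlists d X))]) (dlists (Suc d) X))"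

text \<open>Each piece is a vertex set whose inner edges the kernel retains. The labels of the
  boundary rows already include a vertex adjacent to \<open>S\<close>, so they serve as pieces
  directly.\<close>

definition pieces :: "nat \<Rightarrow> nat list \<Rightarrow> (nat \<times> nat) list \<Rightarrow> nat list list" where
  "pieces d vs es =
     concat (map (clique_pieces (d + 2) es (rest vs es)) (dlists_upto d (cover vs es))) @
     pivot_labels (dlists d (cover vs es)) (boundary_rows d es (rest vs es) (cover vs es))"

definition kernel_edges :: "nat \<Rightarrow> nat list \<Rightarrow> (nat \<times> nat) list \<Rightarrow> (nat \<times> nat) list" where
  "kernel_edges d vs es = filter (\<lambda>e. (fst e \<in> set (cover vs es) \<and> snd e \<in> set (cover vs es)) \<or>
     (\<exists>P\<in>set (pieces d vs es). fst e \<in> set P \<and> snd e \<in> set P)) es"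

text \<open>Dropping isolated vertices bounds the number of vertices by twice the number of edges.
  Colourability is not affected as long as \<open>H\<close> has a vertex.\<close>

definition endpoints :: "nat list \<Rightarrow> (nat \<times> nat) list \<Rightarrow> nat list" where
  "endpoints vs es = filter (\<lambda>v. \<exists>e\<in>set es. v = fst e \<or> v = snd e) vs"

section \<open>Binary counting and the bit string of the kernel\<close>

definition incr :: "bool list \<Rightarrow> bool \<times> bool list" where
  "incr bs = foldl (\<lambda>st b. (fst st \<and> b, (fst st \<noteq> b) # snd st)) (True, []) bs"

definition incr_fixed :: "bool list \<Rightarrow> bool list" where
  "incr_fixed bs = rev (snd (incr bs))"

text \<open>The carry out of the top becomes a new leading bit here, whereas
  \<open>incr_fixed\<close> discards it to keep the width.\<close>

definition incr_bits :: "bool list \<Rightarrow> bool list" where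
  "incr_bits bs = rev (snd (incr bs)) @ (if fst (incr bs) then [True] else [])"

definition length_bits :: "nat list \<Rightarrow> bool list" where
  "length_bits vs = foldl (\<lambda>b _. incr_bits b) [] vs"

definition vertex_code :: "nat list \<Rightarrow> nat \<Rightarrow> bool list" where
  "vertex_code vs u = foldl (\<lambda>b _. incr_fixed b) (map (\<lambda>_. False) (length_bits vs))
     (takeWhile (\<lambda>v. v \<noteq> u) vs)"

definition graph_bits :: "nat list \<Rightarrow> (nat \<times> nat) list \<Rightarrow> bool list" where
  "graph_bits vs es = map (\<lambda>_. True) vs @ False #
     concat (map (\<lambda>e. vertex_code vs (fst e) @ vertex_code vs (snd e)) es)"

definition kernelize ::
  "nat \<Rightarrow> nat list \<times> (nat \<times> nat) list \<Rightarrow> (nat list \<times> (nat \<times> nat) list) \<times> bool list" where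
  "kernelize d g =
     ((endpoints (fst g) (kernel_edges d (fst g) (snd g)), kernel_edges d (fst g) (snd g)),
      graph_bits (endpoints (fst g) (kernel_edges d (fst g) (snd g)))
        (kernel_edges d (fst g) (snd g)))"

subsection \<open>Running time\<close>

lemma polytime_adj [polytime_intros]:
  assumes "polytime es" and "polytime u" and "polytime v"
  shows "polytime (\<lambda>e. adj (es e) (u e) (v e))"
  unfolding adj_def
  by (intro polytime_intros polytime_comp[OF assms(2)] polytime_comp[OF assms(3)] assms)

lemma polytime_adj_twins [polytime_intros]:
  assumes "polytime vs" and "polytime es" and "polytime u" and "polytime v"
  shows "polytime (\<lambda>e. adj_twins (vs e) (es e) (u e) (v e))"
  unfolding adj_twins_def
  by (intro polytime_intros polytime_comp[OF assms(2)] polytime_comp[OF assms(3)]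
      polytime_comp[OF assms(4)] assms)

text \<open>A step adds at most the two ends of the current edge, so the growth is additive.\<close>

lemma polytime_cover [polytime_intros]:
  assumes "polytime vs" and "polytime es"
  shows "polytime (\<lambda>e. cover (vs e) (es e))"
  unfolding cover_def
proof (rule polytime_foldl_additive[where R = "[:1, 1:]"])
  show "polytime (\<lambda>z. cover_step (vs (fst z)) (es (fst z)) (snd (snd z)) (fst (snd z)))"
    unfolding cover_step_def
    by (intro polytime_intros polytime_comp[OF assms(1)] polytime_comp[OF assms(2)])
  show "size (enc (cover_step (vs e) (es e) X x)) \<le> size (enc X) + poly [:1, 1:] (size (enc e) + size (enc x))"
    for e X x by (cases x) (simp add: cover_step_def)
qed (intro polytime_intros assms)+

lemma polytime_rest [polytime_intros]:
  assumes "polytime vs" and "polytime es"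
  shows "polytime (\<lambda>e. rest (vs e) (es e))"
  unfolding rest_def
  by (intro polytime_intros polytime_comp[OF assms(1)] polytime_comp[OF assms(2)] assms)

text \<open>The number \<open>n\<close> is a constant: induction yields a separate program for each
  \<open>n\<close>, and the degree of the polynomial may grow with \<open>n\<close>.\<close>

lemma polytime_dlists [polytime_intros]:
  assumes "polytime X"
  shows "polytime (\<lambda>e. dlists n (X e))"
proof (induction n)
  case (Suc n)
  show ?case
    unfolding dlists.simps by (intro polytime_intros Suc.IH polytime_comp[OF assms])
qed (simp add: polytime_const)

lemma polytime_dlists_upto [polytime_intros]:
  assumes "polytime X"
  shows "polytime (\<lambda>e. dlists_upto n (X e))"
proof (induction n)
  case (Suc n)
  show ?case
    unfolding dlists_upto.simps by (intro polytime_intros Suc.IH assms)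
qed (simp add: polytime_const)

lemma polytime_block [polytime_intros]:
  assumes "polytime es" and "polytime I" and "polytime v"
  shows "polytime (\<lambda>e. block (es e) (I e) (v e))"
  unfolding block_def
  by (intro polytime_intros polytime_comp[OF assms(1)] polytime_comp[OF assms(3)] assms)

lemma polytime_drop [polytime_intros]:
  fixes xs :: "'a::enc \<Rightarrow> 'b::enc list"
  assumes "polytime xs"
  shows "polytime (\<lambda>e. drop n (xs e))"
  using assms
proof (induction n arbitrary: xs)
  case (Suc n)
  show ?case
    unfolding drop_Suc by (rule Suc.IH) (intro polytime_intros Suc.prems)
qed simp

lemma polytime_take [polytime_intros]:
  fixes xs :: "'a::enc \<Rightarrow> 'b::enc list"
  assumes "polytime xs"
  shows "polytime (\<lambda>e. take n (xs e))"
proof -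
  have "polytime (\<lambda>ys :: 'b list. take n ys)"
  proof (induction n)
    case (Suc n)
    have "polytime (\<lambda>ys :: 'b list. case ys of [] \<Rightarrow> [] | z # zs \<Rightarrow> z # take n zs)"
      by (intro polytime_intros polytime_comp[OF Suc.IH])
    moreover have "(\<lambda>ys :: 'b list. case ys of [] \<Rightarrow> [] | z # zs \<Rightarrow> z # take n zs) = take (Suc n)"
      by (rule ext) (simp split: list.split)
    ultimately show ?case by simp
  qed (simp add: polytime_const)
  from polytime_comp[OF this assms] show ?thesis .
qed

lemma polytime_clique_pieces [polytime_intros]:
  assumes "polytime es" and "polytime I" and "polytime S"
  shows "polytime (\<lambda>e. clique_pieces s (es e) (I e) (S e))"
proof (induction s)
  case (Suc s)
  show ?case
    unfolding clique_pieces.simps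
    by (intro polytime_intros Suc.IH polytime_comp[OF assms(1)] polytime_comp[OF assms(2)]
        polytime_comp[OF assms(3)])
qed (simp add: polytime_const)

lemma polytime_lead [polytime_intros]:
  assumes "polytime v"
  shows "polytime (\<lambda>e. lead (v e))"
  unfolding lead_def by (intro polytime_intros assms)

lemma polytime_xor_bits [polytime_intros]:
  assumes "polytime u" and "polytime v"
  shows "polytime (\<lambda>e. xor_bits (u e) (v e))"
  unfolding xor_bits_def by (intro polytime_intros assms)

lemma polytime_pivot_step [polytime_intros]:
  assumes "polytime st"
  shows "polytime (\<lambda>e. pivot_step (st e))"
  unfolding pivot_step_def by (intro polytime_intros polytime_comp[OF assms])

text \<open>Adding rows may turn \<open>False\<close> into the larger tree of \<open>True\<close>,
  so the encoded size can increase during elimination. Here every bit has weight 2, the most it can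
  contribute, so the weight depends only on the labels and the row lengths.\<close>

definition row_weight :: "(nat list \<times> bool list) list \<Rightarrow> nat" where
  "row_weight rows = (\<Sum>r\<leftarrow>rows. size (enc (fst r)) + 2 * length (snd r) + 2)"

lemma size_enc_bools: "size (enc (bs :: bool list)) \<le> 2 * length bs"
proof (induction bs)
  case (Cons b bs)
  then show ?case using size_enc_bool[of b] by simp
qed simp

lemma size_enc_rows_le: "size (enc rows) \<le> row_weight rows"
proof (induction rows)
  case (Cons r rows)
  then show ?case
    using size_enc_bools[of "snd r"] by (simp add: row_weight_def enc_prod_def)
qed (simp add: row_weight_def)

lemma row_weight_le: "row_weight rows \<le> 2 * size (enc rows)"
proof (induction rows)
  case (Cons r rows)
  then show ?case
    using length_le_size_enc[of "snd r"] by (simp add: row_weight_def enc_prod_def)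
qed (simp add: row_weight_def)

lemma length_xor_bits: "length (xor_bits u v) = min (length u) (length v)"
  by (simp add: xor_bits_def)

text \<open>Labels are kept and no row gets longer.\<close>

lemma row_weight_pivot_step: "row_weight (fst (pivot_step st)) \<le> row_weight (fst st)"
  by (auto simp: pivot_step_def row_weight_def o_def length_xor_bits
      intro!: sum_list_mono split: list.split)

lemma size_labels_pivot_step:
  "size (enc (snd (pivot_step st))) \<le> size (enc (snd st)) + row_weight (fst st) + 1"
proof (cases "filter (\<lambda>r. lead (snd r)) (fst st)")
  case (Cons p ps)
  then have "p \<in> set (filter (\<lambda>r. lead (snd r)) (fst st))" by simp
  then have "p \<in> set (fst st)" by simp
  then have "size (enc (fst p)) + 2 * length (snd p) + 2 \<le> row_weight (fst st)"
    unfolding row_weight_def by (intro member_le_sum_list) auto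
  with Cons show ?thesis by (simp add: pivot_step_def)
qed (simp add: pivot_step_def)

text \<open>Since the weight never increases, each column adds at most one label, of size at most
  the initial weight.\<close>

lemma size_foldl_pivot_step:
  "row_weight (fst (foldl (\<lambda>st _. pivot_step st) (rows, []) cols)) \<le> row_weight rows \<and>
   size (enc (snd (foldl (\<lambda>st _. pivot_step st) (rows, []) cols)))
     \<le> length cols * (row_weight rows + 1)"
proof (induction cols rule: rev_induct)
  case (snoc x cols)
  let ?st = "foldl (\<lambda>st _. pivot_step st) (rows, []) cols"
  show ?case
    using snoc row_weight_pivot_step[of ?st] size_labels_pivot_step[of ?st] by simp
qed simp

text \<open>The growth of a step depends on the rows held in the accumulator, so the general fold
  rule is used, with a bound from \<open>size_foldl_pivot_step\<close>.\<close>

lemma polytime_pivot_labels [polytime_intros]: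
  assumes "polytime cols" and "polytime rows"
  shows "polytime (\<lambda>e. pivot_labels (cols e) (rows e))"
proof -
  obtain q where q: "\<And>e. size (enc (rows e)) \<le> poly q (size (enc e))"
    using assms(2) by (rule polytimeE) blast
  let ?B = "smult 2 q + [:0, 1:] * (smult 2 q + [:1:]) + [:1:]"
  have "polytime (\<lambda>e. foldl (\<lambda>st _. pivot_step st) (rows e, []) (cols e))"
  proof (rule polytime_foldl[where B = ?B])
    fix e :: 'a and l :: "nat list list"
    let ?n = "size (enc e) + size (enc l)"
    let ?st = "foldl (\<lambda>st _. pivot_step st) (rows e, []) l"
    have W: "row_weight (rows e) \<le> 2 * poly q ?n"
      using row_weight_le[of "rows e"] q[of e] poly_nat_mono[of "size (enc e)" ?n q] by simp
    have "length l * (row_weight (rows e) + 1) \<le> ?n * (2 * poly q ?n + 1)"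
      using length_le_size_enc[of l] W by (intro mult_mono) auto
    then have "size (enc ?st) \<le> 2 * poly q ?n + ?n * (2 * poly q ?n + 1) + 1"
      using W size_foldl_pivot_step[of "rows e" l] size_enc_rows_le[of "fst ?st"]
      by (simp only: enc_prod_def tree.size) linarith
    then show "size (enc ?st) \<le> poly ?B ?n" by (simp add: algebra_simps)
  qed (intro polytime_intros assms)+
  then show ?thesis unfolding pivot_labels_def by (rule polytime_snd)
qed

lemma polytime_boundary_rows [polytime_intros]:
  assumes "polytime es" and "polytime I" and "polytime X"
  shows "polytime (\<lambda>e. boundary_rows d (es e) (I e) (X e))"
  unfolding boundary_rows_def
  by (intro polytime_intros polytime_comp[OF assms(1)] polytime_comp[OF assms(2)]
      polytime_comp[OF assms(3)])

lemma polytime_pieces [polytime_intros]: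
  assumes "polytime vs" and "polytime es"
  shows "polytime (\<lambda>e. pieces d (vs e) (es e))"
  unfolding pieces_def
  by (intro polytime_intros polytime_comp[OF assms(1)] polytime_comp[OF assms(2)])

lemma polytime_kernel_edges [polytime_intros]:
  assumes "polytime vs" and "polytime es"
  shows "polytime (\<lambda>e. kernel_edges d (vs e) (es e))"
  unfolding kernel_edges_def
  by (intro polytime_intros polytime_comp[OF assms(1)] polytime_comp[OF assms(2)])

lemma polytime_endpoints [polytime_intros]:
  assumes "polytime vs" and "polytime es"
  shows "polytime (\<lambda>e. endpoints (vs e) (es e))"
  unfolding endpoints_def
  by (intro polytime_intros polytime_comp[OF assms(1)] polytime_comp[OF assms(2)])

lemma polytime_incr [polytime_intros]:
  assumes "polytime bs"
  shows "polytime (\<lambda>e. incr (bs e))"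
  unfolding incr_def
proof (rule polytime_foldl_additive[where R = "[:3:]"])
  show "size (enc (fst st \<and> b, (fst st \<noteq> b) # snd st)) \<le> size (enc st) + poly [:3:] (size (enc e) + size (enc b))"
    for e :: 'a and st and b :: bool
    using size_enc_bool[of "fst st \<and> b"] size_enc_bool[of "fst st \<noteq> b"]
    by (simp add: enc_prod_def)
qed (intro polytime_intros assms)+

lemma polytime_incr_fixed [polytime_intros]:
  assumes "polytime bs"
  shows "polytime (\<lambda>e. incr_fixed (bs e))"
  unfolding incr_fixed_def by (intro polytime_intros assms)

lemma polytime_incr_bits [polytime_intros]:
  assumes "polytime bs"
  shows "polytime (\<lambda>e. incr_bits (bs e))"
  unfolding incr_bits_def by (intro polytime_intros assms)

lemma length_incr: "length (snd (incr bs)) = length bs"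
proof -
  have "length (snd (foldl (\<lambda>st b. (fst st \<and> b, (fst st \<noteq> b) # snd st)) st bs))
      = length (snd st) + length bs" for st
    by (induction bs arbitrary: st) auto
  then show ?thesis by (simp add: incr_def)
qed

lemma length_incr_fixed: "length (incr_fixed bs) = length bs"
  by (simp add: incr_fixed_def length_incr)

lemma length_incr_bits: "length (incr_bits bs) \<le> length bs + 1"
  by (simp add: incr_bits_def length_incr)

lemma polytime_length_bits [polytime_intros]:
  assumes "polytime vs"
  shows "polytime (\<lambda>e. length_bits (vs e))"
  unfolding length_bits_def
proof (rule polytime_foldl[where B = "[:0, 2:]"])
  fix e :: 'a and l :: "nat list"
  have "length (foldl (\<lambda>b _. incr_bits b) [] l) \<le> length l"
  proof (induction l rule: rev_induct)
    case (snoc x l)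
    then show ?case using length_incr_bits[of "foldl (\<lambda>b _. incr_bits b) [] l"] by simp
  qed simp
  then show "size (enc (foldl (\<lambda>b _. incr_bits b) [] l)) \<le> poly [:0, 2:] (size (enc e) + size (enc l))"
    using size_enc_bools[of "foldl (\<lambda>b _. incr_bits b) [] l"] length_le_size_enc[of l] by simp
qed (intro polytime_intros assms)+

lemma polytime_takeWhile [polytime_intros]:
  fixes xs :: "'a::enc \<Rightarrow> 'b::enc list"
  assumes P: "polytime (\<lambda>z. P (fst z) (snd z))" and "polytime xs"
  shows "polytime (\<lambda>e. takeWhile (P e) (xs e))"
proof -
  let ?g = "\<lambda>e (st :: bool \<times> 'b list) x. if fst st \<and> P e x then (True, x # snd st) else (False, snd st)"
  have P': "polytime (\<lambda>z :: 'a \<times> 'b \<times> bool \<times> 'b list. P (fst z) (fst (snd z)))"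
  proof -
    have "polytime (\<lambda>z :: 'a \<times> 'b \<times> bool \<times> 'b list. (fst z, fst (snd z)))"
      by (intro polytime_intros)
    from polytime_comp[OF P this] show ?thesis by simp
  qed
  have "polytime (\<lambda>e. foldl (?g e) (True, []) (xs e))"
  proof (rule polytime_foldl_additive[where R = "[:2, 1:]"])
    show "size (enc (?g e st x)) \<le> size (enc st) + poly [:2, 1:] (size (enc e) + size (enc x))"
      for e st x by (simp add: enc_prod_def)
  qed (intro polytime_intros assms P')+
  then have "polytime (\<lambda>e. rev (snd (foldl (?g e) (True, []) (xs e))))"
    by (intro polytime_intros)
  moreover have "snd (foldl (?g e) (False, ys) l) = ys" for e ys l
    by (induction l) auto
  then have "snd (foldl (?g e) (True, ys) l) = rev (takeWhile (P e) l) @ ys" for e ys l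
    by (induction l arbitrary: ys) auto
  ultimately show ?thesis by simp
qed

lemma polytime_vertex_code [polytime_intros]:
  assumes "polytime vs" and "polytime u"
  shows "polytime (\<lambda>e. vertex_code (vs e) (u e))"
proof -
  let ?w = "\<lambda>e. map (\<lambda>_. False) (length_bits (vs e))"
  have w: "polytime ?w" by (intro polytime_intros assms)
  obtain q where q: "\<And>e. size (enc (?w e)) \<le> poly q (size (enc e))"
    using w by (rule polytimeE) blast
  show ?thesis
    unfolding vertex_code_def
  proof (rule polytime_foldl[where B = "smult 2 q"])
    fix e :: 'a and l :: "nat list"
    have "length (foldl (\<lambda>b _. incr_fixed b) (?w e) l) = length (?w e)"
      by (induction l rule: rev_induct) (simp_all add: length_incr_fixed)
    then show "size (enc (foldl (\<lambda>b _. incr_fixed b) (?w e) l)) \<le> poly (smult 2 q) (size (enc e) + size (enc l))"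
      using size_enc_bools[of "foldl (\<lambda>b _. incr_fixed b) (?w e) l"] length_le_size_enc[of "?w e"]
        q[of e] poly_nat_mono[of "size (enc e)" "size (enc e) + size (enc l)" q] by simp
  qed (intro polytime_intros assms polytime_comp[OF assms(2)])+
qed

lemma polytime_graph_bits [polytime_intros]:
  assumes "polytime vs" and "polytime es"
  shows "polytime (\<lambda>e. graph_bits (vs e) (es e))"
  unfolding graph_bits_def
  by (intro polytime_intros polytime_comp[OF assms(1)] polytime_comp[OF assms(2)])

lemma polytime_kernelize: "polytime (kernelize d)"
  unfolding kernelize_def by (intro polytime_intros)

text \<open>Passage from typed functions to functions on trees: on codes, \<open>inv enc\<close> is
  the decoding. Register 0 serves as input and output, as \<open>runs\<close> demands.\<close>

lemma polytime_on_enc: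
  fixes f :: "'a::enc \<Rightarrow> 'b::enc"
  assumes "polytime f"
  shows "polytime_on (range (enc :: 'a \<Rightarrow> tree)) (\<lambda>x. enc (f (inv enc x)))"
proof -
  obtain q where q: "\<And>b i r. i < b \<Longrightarrow> r < b \<Longrightarrow> \<exists>c. implements c b i r f q"
    using assms by (rule polytimeE) blast
  obtain c where c: "implements c 1 0 0 f q" using q[of 0 1 0] by auto
  have "\<exists>t. runs c (enc a) t (enc (f (inv enc (enc a)))) \<and> t \<le> poly q (size (enc a))"
    for a :: 'a
  proof -
    have "((\<lambda>_. Leaf)(0 := enc a)) 0 = enc a" by simp
    with c obtain t s where "exec c ((\<lambda>_. Leaf)(0 := enc a)) t s" "t \<le> poly q (size (enc a))"
      "s 0 = enc (f a)" by (rule implementsE)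
    then show ?thesis unfolding runs_def by (auto simp: inv_f_f[OF inj_enc])
  qed
  then show ?thesis unfolding polytime_on_def by blast
qed

section \<open>The computed twin-cover\<close>

lemma lists_graph_edge_iff:
  assumes "lists_graph vs es G"
  shows "{u, v} \<in> edges G \<longleftrightarrow> (u, v) \<in> set es \<or> (v, u) \<in> set es"
proof -
  have "edges G = (\<lambda>(u, v). {u, v}) ` set es"
    using assms by (auto simp: lists_graph_def)
  then have "{u, v} \<in> edges G \<longleftrightarrow> (\<exists>(a, b)\<in>set es. {u, v} = {a, b})"
    by (simp add: image_iff split_beta)
  then show ?thesis by (auto simp: doubleton_eq_iff)
qed

lemma adj_iff:
  assumes "lists_graph vs es G"
  shows "adj es u v \<longleftrightarrow> {u, v} \<in> edges G"
  unfolding lists_graph_edge_iff[OF assms] adj_def by force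

lemma simple_graph_edgeD:
  assumes "simple_graph G" and "{u, v} \<in> edges G"
  shows "u \<in> verts G" and "v \<in> verts G" and "u \<noteq> v"
  using assms unfolding simple_graph_def by (force simp: doubleton_eq_iff)+

lemma adj_twins_iff:
  assumes "lists_graph vs es G" and "u \<in> verts G" and "v \<in> verts G"
  shows "adj_twins vs es u v \<longleftrightarrow> twins G u v"
proof -
  have "set vs = verts G" using assms(1) by (simp add: lists_graph_def)
  then show ?thesis
    using assms(2,3) unfolding adj_twins_def twins_def closed_nbhd_def adj_iff[OF assms(1)]
    by (auto simp: set_eq_iff)
qed

text \<open>Every pair added consists of the ends of an edge between non-twins, so any twin-cover
  \<open>Y\<close> contains one of them. This vertex of \<open>Y\<close> was not in the set before,
  so each two vertices added are paid for by a new vertex of \<open>Y\<close>.\<close>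

lemma cover_invariant:
  assumes G: "simple_graph G" "lists_graph vs es G" and "set l \<subseteq> set es"
  defines "X \<equiv> foldl (cover_step vs es) [] l"
  shows "distinct X \<and>
    (\<forall>e\<in>set l. fst e \<in> set X \<or> snd e \<in> set X \<or> twins G (fst e) (snd e)) \<and>
    (\<forall>Y. twin_cover G Y \<longrightarrow> length X \<le> 2 * card (Y \<inter> set X))"
  using assms(3) unfolding X_def
proof (induction l rule: rev_induct)
  case (snoc e l)
  let ?X = "foldl (cover_step vs es) [] l"
  obtain u v where e: "e = (u, v)" by (cases e)
  have IH: "distinct ?X"
    "\<forall>e\<in>set l. fst e \<in> set ?X \<or> snd e \<in> set ?X \<or> twins G (fst e) (snd e)"
    "\<forall>Y. twin_cover G Y \<longrightarrow> length ?X \<le> 2 * card (Y \<inter> set ?X)"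
    using snoc by auto
  have edge: "{u, v} \<in> edges G"
    using snoc.prems e by (auto simp: lists_graph_edge_iff[OF G(2)])
  note uv = simple_graph_edgeD[OF G(1) edge]
  show ?case
  proof (cases "u \<in> set ?X \<or> v \<in> set ?X \<or> twins G u v")
    case True
    then have "cover_step vs es ?X e = ?X"
      by (auto simp: cover_step_def e adj_twins_iff[OF G(2) uv(1,2)])
    then show ?thesis using IH True e by simp
  next
    case False
    then have step: "cover_step vs es ?X e = u # v # ?X"
      by (auto simp: cover_step_def e adj_twins_iff[OF G(2) uv(1,2)])
    have "length (u # v # ?X) \<le> 2 * card (Y \<inter> set (u # v # ?X))" if Y: "twin_cover G Y" for Y
    proof -
      have "u \<in> Y \<or> v \<in> Y" using Y edge False unfolding twin_cover_def by blast
      then have "card (Y \<inter> set ?X) < card (Y \<inter> set (u # v # ?X))"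
        using False by (intro psubset_card_mono) auto
      then show ?thesis using IH(3) Y by force
    qed
    then show ?thesis using IH(1,2) False uv step e by auto
  qed
qed simp

lemma
  assumes "simple_graph G" "lists_graph vs es G"
  shows distinct_cover: "distinct (cover vs es)"
    and cover_twins: "{u, v} \<in> edges G \<Longrightarrow>
      u \<in> set (cover vs es) \<or> v \<in> set (cover vs es) \<or> twins G u v"
    and length_cover_le: "twin_cover G Y \<Longrightarrow> length (cover vs es) \<le> 2 * card Y"
proof -
  note inv = cover_invariant[OF assms subset_refl, folded cover_def]
  from inv show "distinct (cover vs es)" by simp
  show "u \<in> set (cover vs es) \<or> v \<in> set (cover vs es) \<or> twins G u v" if "{u, v} \<in> edges G"
    using inv that unfolding lists_graph_edge_iff[OF assms(2)] by (auto simp: twins_def)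
  assume Y: "twin_cover G Y"
  have "finite Y" using Y assms(1) by (auto simp: twin_cover_def simple_graph_def intro: finite_subset)
  then have "card (Y \<inter> set (cover vs es)) \<le> card Y" by (intro card_mono) auto
  with inv Y show "length (cover vs es) \<le> 2 * card Y" by force
qed

section \<open>Tuples and pieces\<close>

lemma filter_eq_Cons_memberD: "filter P xs = y # ys \<Longrightarrow> y \<in> set xs \<and> P y"
  by (drule filter_eq_ConsD) auto

lemma set_dlists: "set (dlists n X) = {S. length S = n \<and> distinct S \<and> set S \<subseteq> set X}"
proof (induction n)
  case (Suc n)
  have "S \<in> set (dlists (Suc n) X) \<longleftrightarrow> length S = Suc n \<and> distinct S \<and> set S \<subseteq> set X" for S
    by (cases S) (auto simp: Suc)
  then show ?case by blast
qed auto

text \<open>Distinctness lets \<open>not_rainbow\<close> count tuples by counting list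
  positions.\<close>

lemma distinct_dlists:
  assumes "distinct X"
  shows "distinct (dlists n X)"
proof (induction n)
  case (Suc n)
  have "distinct (concat (map (\<lambda>S. map (\<lambda>x. x # S) (filter (\<lambda>x. x \<notin> set S) X)) L))"
    if "distinct L" for L
    using that
  proof (induction L)
    case (Cons S L)
    moreover have "distinct (map (\<lambda>x. x # S) (filter (\<lambda>x. x \<notin> set S) X))"
      using assms by (simp add: distinct_map inj_on_def)
    ultimately show ?case by auto
  qed simp
  with Suc show ?case by simp
qed simp

lemma length_dlists_le: "length (dlists n X) \<le> length X ^ n"
proof (induction n)
  case (Suc n)
  have "length (dlists (Suc n) X) \<le> (\<Sum>S\<leftarrow>dlists n X. length X)"
    by (auto simp: length_concat o_def intro!: sum_list_mono)
  also have "\<dots> = length X * length (dlists n X)"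
    by (simp add: sum_list_triv)
  also have "\<dots> \<le> length X ^ Suc n" using Suc by simp
  finally show ?case .
qed simp

lemma set_dlists_upto: "set (dlists_upto n X) = {S. length S \<le> n \<and> distinct S \<and> set S \<subseteq> set X}"
  by (induction n) (auto simp: set_dlists simp del: dlists.simps)

lemma length_dlists_upto_le: "length (dlists_upto n X) \<le> (n + 1) * (length X + 1) ^ n"
proof (induction n)
  case (Suc n)
  have "length (dlists (Suc n) X) \<le> (length X + 1) ^ Suc n"
    using length_dlists_le[of "Suc n" X] power_mono[of "length X" "length X + 1" "Suc n"]
    by linarith
  \<comment> \<open>The base \<open>length X + 1\<close> is positive, so its powers increase with
    the exponent even for empty \<open>X\<close>.\<close>
  moreover have "length (dlists_upto n X) \<le> (n + 1) * (length X + 1) ^ Suc n"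
    using Suc by (rule order_trans) (intro mult_left_mono power_increasing; simp)
  ultimately show ?case by (simp del: dlists.simps power_Suc)
qed simp

lemma length_clique_pieces_le: "length (clique_pieces s es I S) \<le> s"
  by (induction s) (auto split: list.split)

lemma length_clique_piece_le:
  "P \<in> set (clique_pieces s es I S) \<Longrightarrow> length P \<le> s + length S"
  by (induction s) (fastforce split: list.splits)+

text \<open>The retained clique may come from another block than that of \<open>v\<close>; only its
  size and its adjacency to \<open>S\<close> matter for the colouring.\<close>

lemma clique_pieces_complete:
  assumes "1 \<le> j" and "j \<le> s" and "v \<in> set I" and "j \<le> length (block es I v)"
    and "\<forall>x\<in>set S. adj es v x"
  shows "\<exists>v'\<in>set I. j \<le> length (block es I v') \<and> (\<forall>x\<in>set S. adj es v' x) \<and>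
    take j (block es I v') @ S \<in> set (clique_pieces s es I S)"
  using assms(2)
proof (induction s)
  case 0
  then show ?case using assms(1) by simp
next
  case (Suc s)
  show ?case
  proof (cases "j \<le> s")
    case True
    then show ?thesis using Suc.IH by auto
  next
    case False
    then have j: "j = Suc s" using Suc.prems by simp
    let ?F = "filter (\<lambda>v. drop s (block es I v) \<noteq> [] \<and> (\<forall>x\<in>set S. adj es v x)) I"
    have "?F \<noteq> []" using assms(3-5) j by (auto simp: filter_empty_conv intro!: bexI[of _ v])
    then obtain v' vs' where F: "?F = v' # vs'" by (auto simp: neq_Nil_conv)
    then have "v' \<in> set I" "Suc s \<le> length (block es I v')" "\<forall>x\<in>set S. adj es v' x"
      using filter_eq_Cons_memberD[OF F] by auto
    moreover have "take j (block es I v') @ S \<in> set (clique_pieces (Suc s) es I S)"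
      using F j by simp
    ultimately show ?thesis using j by blast
  qed
qed

section \<open>Gaussian elimination\<close>

text \<open>Inner product over the two-element field; a fixed first argument acts as a linear
  functional on rows.\<close>

fun dot :: "bool list \<Rightarrow> bool list \<Rightarrow> bool" where
  "dot (a # as) (b # bs) = ((a \<and> b) \<noteq> dot as bs)"
| "dot _ _ = False"

lemma dot_xor_bits:
  "length u = length v \<Longrightarrow> length m = length v \<Longrightarrow> dot m (xor_bits u v) = (dot m u \<noteq> dot m v)"
proof (induction u v arbitrary: m rule: list_induct2)
  case (Cons a u b v)
  then show ?case by (cases m) (auto simp: xor_bits_def)
qed (simp add: xor_bits_def)

lemma dot_map: "dot (map P l) (map Q l) = odd (length (filter (\<lambda>x. P x \<and> Q x) l))"
  by (induction l) auto

lemma labels_mono: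
  "set (snd st) \<subseteq> set (snd (foldl (\<lambda>st _. pivot_step st) st cols))"
proof (induction cols arbitrary: st)
  case (Cons c cols)
  have "set (snd st) \<subseteq> set (snd (pivot_step st))"
    by (auto simp: pivot_step_def split: list.split)
  with Cons[of "pivot_step st"] show ?case by auto
qed simp

lemma pivot_step_length:
  assumes "\<forall>r\<in>set rows. length (snd r) = Suc n"
  shows "\<forall>r\<in>set (fst (pivot_step (rows, L))). length (snd r) = n"
proof (cases "filter (\<lambda>r. lead (snd r)) rows")
  case Nil
  then show ?thesis using assms by (auto simp: pivot_step_def)
next
  case (Cons p ps)
  then have "length (snd p) = Suc n" using filter_eq_Cons_memberD[OF Cons] assms by simp
  with Cons show ?thesis using assms by (auto simp: pivot_step_def length_xor_bits)
qed

lemma dot_Cons_nonempty: "v \<noteq> [] \<Longrightarrow> dot (a # m) v = ((a \<and> lead v) \<noteq> dot m (tl v))"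
  by (cases v) (auto simp: lead_def)

text \<open>Functionals replace linear combinations. As \<open>m\<close> vanishes on the pivot row,
  adding that row to others does not change their values under \<open>m\<close>, and once the
  leading bits are zero the first entry of \<open>m\<close> may be dropped. The induction thus
  passes to shorter rows with the same labels and values.\<close>

lemma pivots_span:
  assumes "\<forall>r\<in>set rows. length (snd r) = length cols" and "length m = length cols"
    and "\<forall>r\<in>set rows. fst r \<in> set (snd (foldl (\<lambda>st _. pivot_step st) (rows, L) cols)) \<longrightarrow> \<not> dot m (snd r)"
    and "r \<in> set rows"
  shows "\<not> dot m (snd r)"
  using assms
proof (induction cols arbitrary: rows L m r)
  case (Cons c cols)
  obtain a m' where m: "m = a # m'" using Cons.prems(2) by (cases m) auto
  obtain rows1 L1 where st: "pivot_step (rows, L) = (rows1, L1)" by fastforce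
  let ?L = "snd (foldl (\<lambda>st _. pivot_step st) (rows1, L1) cols)"
  have len: "\<forall>r\<in>set rows1. length (snd r) = length cols"
    using pivot_step_length[of rows "length cols" L] Cons.prems(1) st by simp
  \<comment> \<open>\<open>h\<close> is the elimination step on single rows. If there is a pivot,
    its own row becomes zero, in accordance with \<open>m\<close> vanishing on it.\<close>
  have "\<exists>h. rows1 = map h rows \<and> (\<forall>r\<in>set rows. fst (h r) = fst r \<and> dot m' (snd (h r)) = dot m (snd r))"
  proof (cases "filter (\<lambda>r. lead (snd r)) rows")
    case Nil
    then have "dot m' (tl (snd r)) = dot m (snd r)" if "r \<in> set rows" for r
      using Cons.prems(1) that dot_Cons_nonempty[of "snd r" a m'] m
      by (force simp: filter_empty_conv)
    moreover have "rows1 = map (\<lambda>r. (fst r, tl (snd r))) rows"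
      using st Nil by (simp add: pivot_step_def)
    ultimately show ?thesis
      by (intro exI[of _ "\<lambda>r. (fst r, tl (snd r))"]) simp
  next
    case (Cons p ps)
    then have p: "p \<in> set rows" "lead (snd p)" using filter_eq_Cons_memberD[OF Cons] by auto
    let ?h = "\<lambda>r. (fst r, if lead (snd r) then xor_bits (tl (snd p)) (tl (snd r)) else tl (snd r))"
    have step: "rows1 = map ?h rows" "L1 = fst p # L"
      using st Cons by (simp_all add: pivot_step_def)
    \<comment> \<open>The label of \<open>p\<close> stays among the final ones, so the hypothesis on
      pivots applies to \<open>p\<close>.\<close>
    have "fst p \<in> set ?L" using labels_mono[of "(rows1, L1)" cols] step(2) by auto
    then have dp: "\<not> dot m (snd p)" using Cons.prems(3) p(1) st by simp
    have "dot m' (snd (?h r)) = dot m (snd r)" if r: "r \<in> set rows" for r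
    proof -
      have ne: "snd r \<noteq> []" "snd p \<noteq> []" using Cons.prems(1) r p(1) by force+
      have "length (tl (snd p)) = length (tl (snd r))" "length m' = length (tl (snd r))"
        using Cons.prems(1,2) r p(1) m by simp_all
      then show ?thesis
        using dp p(2) unfolding m by (auto simp: dot_Cons_nonempty[OF ne(1)] dot_Cons_nonempty[OF ne(2)] dot_xor_bits)
    qed
    then show ?thesis using step(1) by (intro exI[of _ ?h]) auto
  qed
  then obtain h where h: "rows1 = map h rows" "\<And>r. r \<in> set rows \<Longrightarrow> fst (h r) = fst r"
    "\<And>r. r \<in> set rows \<Longrightarrow> dot m' (snd (h r)) = dot m (snd r)" by blast
  have "\<not> dot m' (snd (h r))"
  proof (rule Cons.IH[OF len])
    show "length m' = length cols" using Cons.prems(2) m by simp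
    show "\<forall>r\<in>set rows1. fst r \<in> set ?L \<longrightarrow> \<not> dot m' (snd r)"
      using Cons.prems(3) st h by auto
    show "h r \<in> set rows1" using h(1) Cons.prems(4) by simp
  qed
  then show ?case using h(3) Cons.prems(4) by simp
qed simp

text \<open>Each column yields at most one label. As the columns will be the \<open>d\<close>-tuples
  of cover vertices, this bounds the number of simplices kept.\<close>

lemma length_pivot_labels_le: "length (pivot_labels cols rows) \<le> length cols"
proof -
  have "length (snd (foldl (\<lambda>st _. pivot_step st) st cols)) \<le> length (snd st) + length cols" for st
  proof (induction cols arbitrary: st)
    case (Cons c cols)
    have "length (snd (pivot_step st)) \<le> length (snd st) + 1"
      by (auto simp: pivot_step_def split: list.split)
    with Cons[of "pivot_step st"] show ?case by simp
  qed simp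
  from this[of "(rows, [])"] show ?thesis by (simp add: pivot_labels_def)
qed

lemma pivot_labels_subset: "set (pivot_labels cols rows) \<subseteq> fst ` set rows"
proof -
  have "set (snd (foldl (\<lambda>st _. pivot_step st) st cols)) \<subseteq> set (snd st) \<union> fst ` set (fst st)" for st
  proof (induction cols arbitrary: st)
    case (Cons c cols)
    have "fst ` set (fst (pivot_step st)) = fst ` set (fst st)"
      by (force simp: pivot_step_def image_iff split: list.split)
    moreover have "set (snd (pivot_step st)) \<subseteq> set (snd st) \<union> fst ` set (fst st)"
    proof (cases "filter (\<lambda>r. lead (snd r)) (fst st)")
      case (Cons p ps)
      then show ?thesis using filter_eq_Cons_memberD[OF Cons] by (auto simp: pivot_step_def)
    qed (simp add: pivot_step_def)
    ultimately show ?case using Cons[of "pivot_step st"] by auto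
  qed simp
  from this[of "(rows, [])"] show ?thesis by (simp add: pivot_labels_def)
qed

section \<open>Parity of rainbow faces\<close>

text \<open>The entries of the tuple are chosen independently, each from the colour class prescribed
  by \<open>C\<close>.\<close>

lemma card_lists_map_eq:
  assumes "finite A"
  shows "card {T. set T \<subseteq> A \<and> map f T = C} = (\<Prod>c\<leftarrow>C. card {x \<in> A. f x = c})"
proof (induction C)
  case Nil
  have "{T. set T \<subseteq> A \<and> map f T = []} = {[]}" by auto
  then show ?case by simp
next
  case (Cons c C)
  have "{T. set T \<subseteq> A \<and> map f T = c # C} =
      (\<lambda>(x, T). x # T) ` ({x \<in> A. f x = c} \<times> {T. set T \<subseteq> A \<and> map f T = C})"
    by (auto simp: map_eq_Cons_conv image_iff)
  moreover have "inj_on (\<lambda>(x, T). x # T) ({x \<in> A. f x = c} \<times> {T. set T \<subseteq> A \<and> map f T = C})"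
    by (auto simp: inj_on_def)
  ultimately show ?case using Cons by (simp add: card_image card_cartesian_product)
qed

text \<open>If the number were odd, all classes of colours in \<open>C\<close> would have odd size.
  Some two elements share a colour \<open>f x\<close>. If \<open>f x\<close> lies in
  \<open>C\<close>, its class has at least 3 elements and each other class of \<open>C\<close> at
  least 1; if not, its class adds at least 2 to the \<open>length C\<close> elements of the others.
  Either way \<open>A\<close> would be too large.\<close>

lemma even_rainbow_faces:
  assumes "finite A" and "card A = Suc (length C)" and "distinct C" and "\<not> inj_on f A"
  shows "even (card {T. set T \<subseteq> A \<and> map f T = C})"
proof (rule ccontr)
  let ?n = "\<lambda>c. card {x \<in> A. f x = c}"
  assume "odd (card {T. set T \<subseteq> A \<and> map f T = C})"
  then have "odd (\<Prod>c\<leftarrow>C. ?n c)" by (simp add: card_lists_map_eq[OF assms(1)])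
  then have "odd (\<Prod>c\<in>set C. ?n c)" using assms(3) by (simp add: prod.distinct_set_conv_list)
  then have od: "odd (?n c)" if "c \<in> set C" for c
    using that by (simp add: even_prod_iff)
  obtain x y where xy: "x \<in> A" "y \<in> A" "x \<noteq> y" "f x = f y" using assms(4) by (auto simp: inj_on_def)
  have two: "2 \<le> ?n (f x)"
    using card_mono[of "{z \<in> A. f z = f x}" "{x, y}"] xy assms(1) by auto
  have "(\<Sum>c\<in>insert (f x) (set C). ?n c) = card (\<Union>c\<in>insert (f x) (set C). {z \<in> A. f z = c})"
    by (rule card_UN_disjoint[symmetric]) (use assms(1) in auto)
  also have "\<dots> \<le> card A" using assms(1) by (intro card_mono) auto
  finally have le: "(\<Sum>c\<in>insert (f x) (set C). ?n c) \<le> Suc (length C)" using assms(2) by simp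
  have one: "1 \<le> ?n c" if "c \<in> set C" for c using od[OF that] by (cases "?n c") auto
  have "(\<Sum>c\<in>set C - {f x}. 1) \<le> (\<Sum>c\<in>set C - {f x}. ?n c)"
    by (rule sum_mono) (use one in auto)
  then have rem: "card (set C - {f x}) \<le> (\<Sum>c\<in>set C - {f x}. ?n c)" by simp
  have eq: "(\<Sum>c\<in>insert (f x) (set C). ?n c) = ?n (f x) + (\<Sum>c\<in>set C - {f x}. ?n c)"
    by (simp add: sum.insert_remove)
  show False
  proof (cases "f x \<in> set C")
    case True
    then have "?n (f x) \<ge> 3" using od two by (metis Suc_leI antisym_conv1 even_numeral numeral_2_eq_2 numeral_3_eq_3)
    moreover have "card (set C - {f x}) = length C - 1" "length C \<ge> 1"
      using True distinct_card[OF assms(3)] by (auto simp: Suc_le_eq)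
    ultimately show False using le eq rem by linarith
  next
    case False
    then have "card (set C - {f x}) = length C" using distinct_card[OF assms(3)] by simp
    then show False using le eq rem two by linarith
  qed
qed

text \<open>Every factor in the product of class sizes is 1.\<close>

lemma odd_rainbow_faces:
  assumes "finite A" and "inj_on f A" and "set C \<subseteq> f ` A"
  shows "odd (card {T. set T \<subseteq> A \<and> map f T = C})"
proof -
  have "card {x \<in> A. f x = c} = 1" if c: "c \<in> set C" for c
  proof -
    obtain x where "x \<in> A" "f x = c" using c assms(3) by auto
    then have "{x \<in> A. f x = c} = {x}" using assms(2) by (auto simp: inj_on_def)
    then show ?thesis by simp
  qed
  then have "(\<Prod>c\<leftarrow>C. card {x \<in> A. f x = c}) = 1"
    by (induction C) auto
  then show ?thesis by (simp add: card_lists_map_eq[OF assms(1)])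
qed

section \<open>Extending a colouring of the kernel\<close>

text \<open>
  A block of \<open>s\<close> twins whose outer neighbours received the colours \<open>C\<close> can be coloured iff
  \<open>clique_ext H C s\<close>.
\<close>

definition clique_ext :: "'h ugraph \<Rightarrow> 'h set \<Rightarrow> nat \<Rightarrow> bool" where
  "clique_ext H C s \<longleftrightarrow> (\<exists>Q. Q \<subseteq> verts H \<and> card Q = s \<and>
     (\<forall>p\<in>Q. \<forall>q\<in>Q. p \<noteq> q \<longrightarrow> {p, q} \<in> edges H) \<and> (\<forall>q\<in>Q. \<forall>c\<in>C. {q, c} \<in> edges H))"

lemma neighbours_card_le:
  assumes "simple_graph H" and "v \<in> verts H" and "\<forall>u\<in>A. {v, u} \<in> edges H"
  shows "finite A" and "card A \<le> max_degree H"
proof -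
  let ?N = "{u \<in> verts H. {v, u} \<in> edges H}"
  have fin: "finite (verts H)" using assms(1) by (simp add: simple_graph_def)
  have sub: "A \<subseteq> ?N" using simple_graph_edgeD(2)[OF assms(1)] assms(3) by blast
  then show "finite A" using fin by (auto intro: finite_subset)
  have "card A \<le> card ?N" using sub fin by (intro card_mono) auto
  also have "\<dots> = vertex_degree H v" by (simp add: vertex_degree_def)
  also have "\<dots> \<le> max_degree H" unfolding max_degree_def using fin assms(2) by (intro Max_ge) auto
  finally show "card A \<le> max_degree H" .
qed

text \<open>A member \<open>q\<close> of the clique is adjacent to all of \<open>C\<close> and to
  the other \<open>s - 1\<close> members. These sets are disjoint because \<open>H\<close> has no
  loops, so \<open>q\<close> has degree at least \<open>card C + s - 1\<close>.\<close>

lemma clique_ext_card_le: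
  assumes H: "simple_graph H" and "clique_ext H C s" and "1 \<le> s"
  shows "card C + s \<le> max_degree H + 1"
proof -
  obtain Q where Q: "Q \<subseteq> verts H" "card Q = s" "\<forall>p\<in>Q. \<forall>q\<in>Q. p \<noteq> q \<longrightarrow> {p, q} \<in> edges H"
    "\<forall>q\<in>Q. \<forall>c\<in>C. {q, c} \<in> edges H"
    using assms(2) unfolding clique_ext_def by blast
  have finQ: "finite Q" using Q(1) H by (auto simp: simple_graph_def intro: finite_subset)
  obtain q where q: "q \<in> Q" using Q(2) assms(3) by (metis card.empty ex_in_conv not_one_le_zero)
  have nb: "\<forall>u\<in>C \<union> (Q - {q}). {q, u} \<in> edges H" using Q(3,4) q by auto
  have "q \<in> verts H" using q Q(1) by blast
  note deg = neighbours_card_le[OF H this nb]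
  have "C \<inter> (Q - {q}) = {}" using Q(4) simple_graph_edgeD(3)[OF H] by blast
  then have "card (C \<union> (Q - {q})) = card C + card (Q - {q})"
    using deg(1) by (intro card_Un_disjoint) auto
  moreover have "card (Q - {q}) = s - 1" using q finQ Q(2) by simp
  ultimately show ?thesis using deg(2) assms(3) by simp
qed

text \<open>Setting for lifting a colouring of the kernel to \<open>G\<close>. Taking
  \<open>f\<close> total with values in \<open>H\<close> avoids case distinctions on membership in
  the kernel.\<close>

locale kernel_coloring =
  fixes H :: "'h ugraph" and G :: "nat ugraph" and vs es f d
  assumes H: "simple_graph H" and G: "simple_graph G" and lists: "lists_graph vs es G"
    and d: "d = max_degree H"
    and f_verts: "\<And>x. f x \<in> verts H"
    and f_edges: "\<And>u v. (u, v) \<in> set (kernel_edges d vs es) \<Longrightarrow> {f u, f v} \<in> edges H"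
begin

section \<open>Adjacency and the blocks of twins outside the cover\<close>

abbreviation "X \<equiv> cover vs es"
abbreviation "I \<equiv> rest vs es"

lemma adj_edge: "adj es u v \<longleftrightarrow> {u, v} \<in> edges G"
  by (rule adj_iff[OF lists])

lemma adj_sym: "adj es u v \<longleftrightarrow> adj es v u"
  by (simp add: adj_edge insert_commute)

lemma adj_verts: "adj es u v \<Longrightarrow> u \<in> verts G" "adj es u v \<Longrightarrow> v \<in> verts G" "adj es u v \<Longrightarrow> u \<noteq> v"
  using simple_graph_edgeD[OF G] by (auto simp: adj_edge)

lemma set_rest: "set I = verts G - set X"
  using lists by (auto simp: rest_def lists_graph_def)

lemma f_cover_edge:
  assumes "adj es u v" and "u \<in> set X" and "v \<in> set X"
  shows "{f u, f v} \<in> edges H"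
proof -
  have "(u, v) \<in> set (kernel_edges d vs es) \<or> (v, u) \<in> set (kernel_edges d vs es)"
    using assms unfolding adj_edge lists_graph_edge_iff[OF lists] by (auto simp: kernel_edges_def)
  then show ?thesis using f_edges[of u v] f_edges[of v u] by (auto simp: insert_commute)
qed

lemma f_piece_edge:
  assumes "adj es u v" and "P \<in> set (pieces d vs es)" and "u \<in> set P" and "v \<in> set P"
  shows "{f u, f v} \<in> edges H"
proof -
  have "(u, v) \<in> set (kernel_edges d vs es) \<or> (v, u) \<in> set (kernel_edges d vs es)"
    using assms unfolding adj_edge lists_graph_edge_iff[OF lists] by (auto simp: kernel_edges_def)
  then show ?thesis using f_edges[of u v] f_edges[of v u] by (auto simp: insert_commute)
qed

text \<open>Neither end of an edge inside \<open>I\<close> lies in the cover, so the cover property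
  leaves only that the ends are twins.\<close>

lemma block_twins:
  assumes "v \<in> set I" and "u \<in> set (block es I v)"
  shows "u \<in> set I" and "closed_nbhd G u = closed_nbhd G v"
proof -
  show u: "u \<in> set I" using assms(2) by (simp add: block_def)
  show "closed_nbhd G u = closed_nbhd G v"
  proof (cases "u = v")
    case False
    then have "{u, v} \<in> edges G" using assms(2) by (simp add: block_def adj_edge)
    from cover_twins[OF G lists this] u assms(1) show ?thesis by (auto simp: set_rest twins_def)
  qed simp
qed

lemma closed_nbhd_iff: "u \<in> verts G \<Longrightarrow> w \<in> closed_nbhd G u \<longleftrightarrow> w = u \<or> adj es u w"
  using adj_verts by (auto simp: closed_nbhd_def adj_edge)

lemma block_adj:
  assumes "v \<in> set I" and "u \<in> set (block es I v)" and "w = v \<or> adj es v w" and "u \<noteq> w"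
  shows "adj es u w"
proof -
  have "u \<in> verts G" "v \<in> verts G" using block_twins(1)[OF assms(1,2)] assms(1) by (auto simp: set_rest)
  then show ?thesis
    using block_twins(2)[OF assms(1,2)] assms(3,4) closed_nbhd_iff[of u w] closed_nbhd_iff[of v w]
    by auto
qed

lemma block_eq:
  assumes "v \<in> set I" and "u \<in> set (block es I v)"
  shows "set (block es I u) = set (block es I v)"
proof -
  have "u \<in> verts G" "v \<in> verts G" using block_twins(1)[OF assms] assms(1) by (auto simp: set_rest)
  then have "w = u \<or> adj es w u \<longleftrightarrow> w = v \<or> adj es w v" for w
    using block_twins(2)[OF assms] closed_nbhd_iff adj_sym by blast
  then show ?thesis by (simp add: block_def)
qed

lemma block_self: "v \<in> set I \<Longrightarrow> v \<in> set (block es I v)"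
  by (simp add: block_def)

lemma distinct_block: "distinct (block es I v)"
  using lists by (simp add: block_def rest_def lists_graph_def)

text \<open>Some piece consists of \<open>j\<close> vertices of a block and \<open>S\<close>, and
  all edges inside it are in the kernel. The clique keeps its size under \<open>f\<close> because
  \<open>H\<close> has no loops, so its image is the clique required.\<close>

lemma clique_ext_small:
  assumes "v \<in> set I" and "1 \<le> j" and "j \<le> d + 2" and "j \<le> length (block es I v)"
    and S: "distinct S" "set S \<subseteq> set X" "length S \<le> d" "\<forall>x\<in>set S. adj es v x"
  shows "clique_ext H (f ` set S) j"
proof -
  obtain v' where v': "v' \<in> set I" "j \<le> length (block es I v')" "\<forall>x\<in>set S. adj es v' x"
    and P: "take j (block es I v') @ S \<in> set (clique_pieces (d + 2) es I S)"
    using clique_pieces_complete[OF assms(2,3,1,4) S(4)] by blast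
  let ?K = "take j (block es I v')"
  have "S \<in> set (dlists_upto d X)" using S by (simp add: set_dlists_upto)
  then have piece: "?K @ S \<in> set (pieces d vs es)" using P
    unfolding pieces_def set_append set_concat set_map by blast
  have K: "u \<in> set (block es I v')" if "u \<in> set ?K" for u using that by (rule in_set_takeD)
  have clique: "{f u, f w} \<in> edges H" if "u \<in> set ?K" "w \<in> set ?K" "u \<noteq> w" for u w
  proof (rule f_piece_edge[OF _ piece])
    show "adj es u w"
      using block_adj[OF v'(1) K[OF that(1)], of w] K[OF that(2)] that(3) adj_sym
      by (auto simp: block_def)
  qed (use that in auto)
  then have "inj_on f (set ?K)"
    using simple_graph_edgeD(3)[OF H] by (fastforce simp: inj_on_def)
  then have "card (f ` set ?K) = j"
    using distinct_card[of ?K] distinct_block v'(2) by (simp add: card_image)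
  moreover have "{f u, f x} \<in> edges H" if "u \<in> set ?K" "x \<in> set S" for u x
  proof (rule f_piece_edge[OF _ piece])
    have "u \<noteq> x" using block_twins(1)[OF v'(1) K[OF that(1)]] that(2) S(2) by (auto simp: set_rest)
    then show "adj es u x" using block_adj[OF v'(1) K[OF that(1)], of x] v'(3) that(2) by simp
  qed (use that in auto)
  moreover have "f ` set ?K \<subseteq> verts H" using f_verts by auto
  ultimately show ?thesis
    unfolding clique_ext_def by (intro exI[of _ "f ` set ?K"]) (auto intro!: clique)
qed

text \<open>The functional \<open>?m\<close> marks the tuples with a fixed colour pattern
  \<open>?C\<close>. On the row of \<open>A\<close> its value is the parity of the number of faces
  of \<open>A\<close> with this pattern. It is even for every pivot row, whose retained neighbour
  \<open>u\<close> forbids injectivity on \<open>A\<close>, hence for every row by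
  \<open>pivots_span\<close>; but for an injectively coloured \<open>S\<close> it would be
  odd.\<close>

lemma not_rainbow:
  assumes "v \<in> set I" and S: "distinct S" "set S \<subseteq> set X" "length S = Suc d"
    and "\<forall>x\<in>set S. adj es v x"
  shows "\<not> inj_on f (set S)"
proof
  assume inj: "inj_on f (set S)"
  let ?Ts = "dlists d X"
  let ?rows = "boundary_rows d es I X"
  let ?vec = "\<lambda>S. map (\<lambda>T. \<forall>x\<in>set T. x \<in> set S) ?Ts"
  \<comment> \<open>Any \<open>d\<close> of the \<open>d + 1\<close> colours on \<open>S\<close>
    could form the pattern; those of \<open>S'\<close> are taken.\<close>
  obtain s S' where SS': "S = s # S'" "length S' = d" using S(3) by (cases S) auto
  let ?C = "map f S'"
  let ?m = "map (\<lambda>T. map f T = ?C) ?Ts"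
  have C: "distinct ?C" "length ?C = d"
    using S(1) inj SS' by (auto simp: distinct_map intro: inj_on_subset)
  have dot: "dot ?m (?vec A) \<longleftrightarrow> odd (card {T. set T \<subseteq> set A \<and> map f T = ?C})"
    if "set A \<subseteq> set X" for A
  proof -
    have "length (filter (\<lambda>T. map f T = ?C \<and> (\<forall>x\<in>set T. x \<in> set A)) ?Ts)
        = card (set (filter (\<lambda>T. map f T = ?C \<and> (\<forall>x\<in>set T. x \<in> set A)) ?Ts))"
      using distinct_dlists[OF distinct_cover[OF G lists]] by (intro distinct_card[symmetric]) simp
    also have "set (filter (\<lambda>T. map f T = ?C \<and> (\<forall>x\<in>set T. x \<in> set A)) ?Ts)
        = {T. set T \<subseteq> set A \<and> map f T = ?C}"
    proof -
      \<comment> \<open>A tuple with pattern \<open>?C\<close> automatically has length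
        \<open>d\<close> and distinct entries, so all such tuples inside \<open>A\<close> occur
        among the columns.\<close>
      have "length T = d \<and> distinct T" if "map f T = ?C" for T
        using C that by (metis distinct_map length_map)
      then show ?thesis using that by (auto simp: set_dlists)
    qed
    finally show ?thesis by (simp add: dot_map)
  qed
  have rows: "\<exists>u A. r = (u # A, ?vec A) \<and> u \<in> set I \<and> (\<forall>x\<in>set A. adj es u x) \<and>
      length A = Suc d \<and> distinct A \<and> set A \<subseteq> set X" if r: "r \<in> set ?rows" for r
  proof -
    from r obtain A where A: "A \<in> set (dlists (Suc d) X)"
      and rA: "r \<in> set (case filter (\<lambda>v. \<forall>x\<in>set A. adj es v x) I of [] \<Rightarrow> []
        | v # _ \<Rightarrow> [(v # A, ?vec A)])"
      unfolding boundary_rows_def set_concat set_map by blast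
    from rA obtain u us where F: "filter (\<lambda>v. \<forall>x\<in>set A. adj es v x) I = u # us"
      and "r = (u # A, ?vec A)"
      by (cases "filter (\<lambda>v. \<forall>x\<in>set A. adj es v x) I") auto
    with filter_eq_Cons_memberD[OF F] A show ?thesis unfolding set_dlists by blast
  qed
  have pivots: "\<not> dot ?m (snd r)"
    if r: "r \<in> set ?rows" and piv: "fst r \<in> set (pivot_labels ?Ts ?rows)" for r
  proof -
    obtain u A where A: "r = (u # A, ?vec A)" "u \<in> set I" "\<forall>x\<in>set A. adj es u x"
      "length A = Suc d" "distinct A" "set A \<subseteq> set X" using rows[OF r] by blast
    have piece: "u # A \<in> set (pieces d vs es)" using piv A(1) by (simp add: pieces_def)
    \<comment> \<open>Otherwise \<open>f u\<close> would have \<open>d + 1\<close> distinct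
      neighbours in \<open>H\<close>.\<close>
    have "\<not> inj_on f (set A)"
    proof
      assume "inj_on f (set A)"
      then have "card (f ` set A) = Suc d" using A(4,5) by (simp add: card_image distinct_card)
      moreover have "\<forall>c\<in>f ` set A. {f u, c} \<in> edges H"
        using f_piece_edge[OF _ piece] A(3) by simp
      then have "card (f ` set A) \<le> d"
        unfolding d by (intro neighbours_card_le(2)[OF H f_verts])
      ultimately show False by simp
    qed
    then have "even (card {T. set T \<subseteq> set A \<and> map f T = ?C})"
      using even_rainbow_faces[of "set A" ?C f] C A(4) distinct_card[OF A(5)] by simp
    then show ?thesis using dot[OF A(6)] A(1) by simp
  qed
  have "filter (\<lambda>v. \<forall>x\<in>set S. adj es v x) I \<noteq> []"
    using assms(1,5) by (auto simp: filter_empty_conv)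
  then obtain u us where "filter (\<lambda>v. \<forall>x\<in>set S. adj es v x) I = u # us"
    by (auto simp: neq_Nil_conv)
  moreover have "S \<in> set (dlists (Suc d) X)" using S unfolding set_dlists by simp
  ultimately have row: "(u # S, ?vec S) \<in> set ?rows"
    unfolding boundary_rows_def set_concat set_map by force
  have "\<not> dot ?m (snd (u # S, ?vec S))"
  proof (rule pivots_span[where cols = ?Ts and L = "[]", OF _ _ _ row])
    show "\<forall>r\<in>set ?rows. length (snd r) = length ?Ts" using rows by force
    show "\<forall>r\<in>set ?rows. fst r \<in> set (snd (foldl (\<lambda>st _. pivot_step st) (?rows, []) ?Ts)) \<longrightarrow>
        \<not> dot ?m (snd r)"
      using pivots unfolding pivot_labels_def by blast
  qed simp
  moreover have "odd (card {T. set T \<subseteq> set S \<and> map f T = ?C})"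
    using inj SS'(1) by (intro odd_rainbow_faces) auto
  ultimately show False using dot[OF S(2)] by simp
qed

text \<open>A minimal set of colours obstructing the extension has at most \<open>d + 1\<close>
  elements. With at most \<open>d\<close> it is refuted by a retained clique piece; with
  \<open>d + 1\<close> it is refuted by \<open>not_rainbow\<close>.\<close>

lemma clique_ext_block:
  assumes v: "v \<in> set I"
  defines "N \<equiv> {x \<in> set X. adj es v x}"
  shows "clique_ext H (f ` N) (length (block es I v))"
proof -
  \<comment> \<open>Pieces are available up to size \<open>d + 2\<close>. As \<open>H\<close> has no
    clique of that size, success for the minimum shows that \<open>s\<close> is the full block
    size.\<close>
  define s where "s = min (length (block es I v)) (d + 2)"
  have s: "1 \<le> s" "s \<le> d + 2" "s \<le> length (block es I v)"
    using block_self[OF v] unfolding s_def by (auto simp: Suc_le_eq)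
  have ext: "clique_ext H (f ` N) s"
  proof (rule ccontr)
    assume not: "\<not> clique_ext H (f ` N) s"
    let ?F = "{C \<in> Pow (f ` N). \<not> clique_ext H C s}"
    have "finite ?F" unfolding N_def by simp
    moreover have "?F \<noteq> {}" using not by blast
    ultimately obtain C where C: "C \<in> ?F" and min: "\<forall>B\<in>?F. B \<subseteq> C \<longrightarrow> C = B"
      using finite_has_minimal[of ?F] by blast
    have "C \<subseteq> f ` N" using C by simp
    \<comment> \<open>One vertex for each colour of \<open>C\<close>, so that \<open>f\<close> is
      injective on \<open>S0\<close>.\<close>
    then obtain S0 where S0: "S0 \<subseteq> N" "inj_on f S0" "C = f ` S0"
      unfolding subset_image_inj by blast
    have "finite S0" using S0(1) by (rule finite_subset) (simp add: N_def)
    then obtain S where S: "set S = S0" "distinct S" using finite_distinct_list by blast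
    have len: "length S = card C" using S S0 distinct_card[of S] by (simp add: card_image)
    have SX: "set S \<subseteq> set X" "\<forall>x\<in>set S. adj es v x" using S(1) S0(1) by (auto simp: N_def)
    show False
    proof (cases "length S \<le> d")
      case True
      from clique_ext_small[OF v s S(2) SX(1) True SX(2)] C S S0 show False by simp
    next
      case False
      then obtain c where c: "c \<in> C" using len by (metis card.empty ex_in_conv le0)
      \<comment> \<open>Minimality makes \<open>C - {c}\<close> extendable, and the degree bound
        then limits \<open>card C\<close> to \<open>d + 2 - s\<close>.\<close>
      then have "clique_ext H (C - {c}) s" using min C by blast
      from clique_ext_card_le[OF H this s(1)] have "card C - 1 + s \<le> d + 1"
        using c C d by (simp add: card_Diff_singleton_if)
      then have "length S = Suc d" using False s(1) len by linarith
      from not_rainbow[OF v S(2) SX(1) this SX(2)] S(1) S0(2) show False by simp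
    qed
  qed
  from clique_ext_card_le[OF H ext s(1)] have "s \<le> d + 1" using d by simp
  then have "s = length (block es I v)" by (simp add: s_def)
  with ext show ?thesis by simp
qed

section \<open>Assembling a colouring of the whole graph from the blocks\<close>

definition block_coloring :: "nat set \<Rightarrow> (nat \<Rightarrow> 'h) \<Rightarrow> bool" where
  "block_coloring K h \<longleftrightarrow> (\<forall>u\<in>K. h u \<in> verts H) \<and>
     (\<forall>u\<in>K. \<forall>w\<in>K. u \<noteq> w \<longrightarrow> {h u, h w} \<in> edges H) \<and>
     (\<forall>u\<in>K. \<forall>x\<in>set X. adj es u x \<longrightarrow> {h u, f x} \<in> edges H)"

text \<open>A bijection from the block onto the clique given by \<open>clique_ext_block\<close>
  works: twins have the same neighbours in the cover, so any vertex of the block can take any colour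
  of the clique.\<close>

lemma block_coloring_exists:
  assumes v: "v \<in> set I"
  shows "\<exists>h. block_coloring (set (block es I v)) h"
proof -
  let ?K = "set (block es I v)"
  obtain Q where Q: "Q \<subseteq> verts H" "card Q = length (block es I v)"
    "\<forall>p\<in>Q. \<forall>q\<in>Q. p \<noteq> q \<longrightarrow> {p, q} \<in> edges H"
    "\<forall>q\<in>Q. \<forall>c\<in>f ` {x \<in> set X. adj es v x}. {q, c} \<in> edges H"
    using clique_ext_block[OF v] unfolding clique_ext_def by blast
  have "finite Q" using Q(1) H by (auto simp: simple_graph_def intro: finite_subset)
  moreover have "card ?K = card Q" using distinct_card[OF distinct_block] Q(2) by simp
  ultimately obtain h where h: "bij_betw h ?K Q"
    using finite_same_card_bij[of ?K Q] by auto
  have hQ: "h u \<in> Q" if "u \<in> ?K" for u using h that by (auto simp: bij_betw_def)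
  have "{h u, h w} \<in> edges H" if "u \<in> ?K" "w \<in> ?K" "u \<noteq> w" for u w
  proof -
    have "h u \<noteq> h w" using h that unfolding bij_betw_def inj_on_def by blast
    then show ?thesis using Q(3) hQ that by blast
  qed
  moreover have "{h u, f x} \<in> edges H" if "u \<in> ?K" "x \<in> set X" "adj es u x" for u x
  proof -
    have "v \<noteq> x" using v that(2) by (auto simp: set_rest)
    moreover have "v \<in> set (block es I u)" using block_eq[OF v that(1)] block_self[OF v] by simp
    ultimately have "adj es v x"
      using block_adj[OF block_twins(1)[OF v that(1)]] that(3) by blast
    then show ?thesis using Q(4) hQ[OF that(1)] that(2) by blast
  qed
  ultimately show ?thesis using hQ Q(1) unfolding block_coloring_def by blast
qed

lemma colorable: "colorable H G"
proof -
  \<comment> \<open>The choice depends on the block as a set, so all its vertices use the same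
    colouring.\<close>
  obtain k where good: "\<And>u. u \<in> set I \<Longrightarrow> block_coloring (set (block es I u)) (k (set (block es I u)))"
  proof
    show "block_coloring (set (block es I u)) (SOME h. block_coloring (set (block es I u)) h)" if "u \<in> set I" for u
      using block_coloring_exists[OF that] by (rule someI_ex)
  qed
  define g where "g u = (if u \<in> set X then f u else k (set (block es I u)) u)" for u
  have "g u \<in> verts H" if "u \<in> verts G" for u
  proof (cases "u \<in> set X")
    case False
    then have u: "u \<in> set I" using that by (simp add: set_rest)
    then show ?thesis using good[OF u] block_self[OF u] False by (simp add: g_def block_coloring_def)
  qed (simp add: g_def f_verts)
  moreover have mixed: "{g u, g x} \<in> edges H" if "adj es u x" "u \<notin> set X" "x \<in> set X" for u x
  proof -
    have u: "u \<in> set I" using that adj_verts by (simp add: set_rest)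
    then show ?thesis using good[OF u] block_self[OF u] that by (simp add: g_def block_coloring_def)
  qed
  have "{g u, g v} \<in> edges H" if e: "{u, v} \<in> edges G" for u v
  proof -
    have adj: "adj es u v" using e by (simp add: adj_edge)
    consider "u \<in> set X" "v \<in> set X" | "u \<notin> set X" "v \<in> set X" | "u \<in> set X" "v \<notin> set X"
      | "u \<notin> set X" "v \<notin> set X" by blast
    then show ?thesis
    proof cases
      case 1
      then show ?thesis using f_cover_edge[OF adj] by (simp add: g_def)
    next
      case 2
      then show ?thesis using mixed adj by blast
    next
      case 3
      then show ?thesis using mixed adj adj_sym by (metis insert_commute)
    next
      case 4
      then have uv: "u \<in> set I" "v \<in> set I" using adj_verts[OF adj] by (auto simp: set_rest)
      \<comment> \<open>Adjacent vertices outside the cover lie in a common block.\<close>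
      then have K: "u \<in> set (block es I v)" using adj by (simp add: block_def)
      then show ?thesis
        using good[OF uv(2)] block_eq[OF uv(2) K] block_self[OF uv(2)] adj_verts(3)[OF adj] 4
        by (simp add: g_def block_coloring_def)
    qed
  qed
  ultimately show ?thesis unfolding colorable_def by blast
qed

end

section \<open>Size of the kernel\<close>

text \<open>Each tuple of at most \<open>d\<close> cover vertices yields up to \<open>d + 2\<close>
  clique pieces; the pivots account for the last summand 1.\<close>

lemma length_pieces_le:
  "length (pieces d vs es) \<le> ((d + 2) * (d + 1) + 1) * (length (cover vs es) + 1) ^ d"
proof -
  let ?X = "cover vs es" and ?I = "rest vs es"
  have "length (concat (map (clique_pieces (d + 2) es ?I) (dlists_upto d ?X)))
      \<le> (\<Sum>S\<leftarrow>dlists_upto d ?X. d + 2)"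
    unfolding length_concat map_map o_def by (intro sum_list_mono length_clique_pieces_le)
  also have "\<dots> = (d + 2) * length (dlists_upto d ?X)" by (simp add: sum_list_triv)
  also have "\<dots> \<le> (d + 2) * ((d + 1) * (length ?X + 1) ^ d)"
    by (intro mult_left_mono length_dlists_upto_le) simp
  finally have 1: "length (concat (map (clique_pieces (d + 2) es ?I) (dlists_upto d ?X)))
      \<le> (d + 2) * (d + 1) * (length ?X + 1) ^ d" by (simp only: mult.assoc)
  have "length (pivot_labels (dlists d ?X) (boundary_rows d es ?I ?X)) \<le> length ?X ^ d"
    by (rule order_trans[OF length_pivot_labels_le length_dlists_le])
  also have "\<dots> \<le> (length ?X + 1) ^ d" by (rule power_mono) simp_all
  finally show ?thesis using 1 unfolding pieces_def length_append add_mult_distrib mult_1 by linarith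
qed

text \<open>A clique piece has at most \<open>d + 2\<close> clique vertices and \<open>d\<close>
  cover vertices; a simplex piece has length \<open>d + 2\<close>.\<close>

lemma length_piece_le:
  assumes "P \<in> set (pieces d vs es)"
  shows "length P \<le> 2 * d + 2"
proof -
  let ?X = "cover vs es" and ?I = "rest vs es"
  from assms consider S where "S \<in> set (dlists_upto d ?X)" "P \<in> set (clique_pieces (d + 2) es ?I S)"
    | "P \<in> set (pivot_labels (dlists d ?X) (boundary_rows d es ?I ?X))"
    unfolding pieces_def by (auto simp del: clique_pieces.simps add_2_eq_Suc')
  then show ?thesis
  proof cases
    case 1
    then show ?thesis using length_clique_piece_le[of P "d + 2"] unfolding set_dlists_upto by force
  next
    case 2
    then have "P \<in> fst ` set (boundary_rows d es ?I ?X)" using pivot_labels_subset by blast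
    then obtain S v where "S \<in> set (dlists (Suc d) ?X)" "P = v # S"
      unfolding boundary_rows_def by (auto simp del: dlists.simps split: list.splits)
    then show ?thesis unfolding set_dlists by simp
  qed
qed

text \<open>The leading 1 pays for the edges inside the cover, the other summand for the number of
  pieces times the pairs inside one piece.\<close>

definition size_const :: "nat \<Rightarrow> nat" where
  "size_const d = 1 + ((d + 2) * (d + 1) + 1) * (2 * d + 2) ^ 2"

lemma card_kernel_edges_le:
  assumes "2 \<le> d"
  shows "card ((\<lambda>(u, v). {u, v}) ` set (kernel_edges d vs es))
    \<le> size_const d * (length (cover vs es) + 1) ^ d"
proof -
  let ?X = "cover vs es" and ?E = "\<lambda>A. (\<lambda>(u, v). {u, v}) ` (A \<times> A)"
  let ?P = "set (pieces d vs es)"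
  let ?n = "(length ?X + 1) ^ d"
  have card: "card (?E (set A)) \<le> (length A) ^ 2" for A :: "nat list"
  proof -
    have "card (?E (set A)) \<le> card (set A \<times> set A)" by (intro card_image_le) simp
    also have "\<dots> = card (set A) ^ 2" by (simp add: card_cartesian_product power2_eq_square)
    also have "\<dots> \<le> length A ^ 2" by (intro power_mono card_length) simp
    finally show ?thesis .
  qed
  have "(\<lambda>(u, v). {u, v}) ` set (kernel_edges d vs es) \<subseteq> ?E (set ?X) \<union> (\<Union>A\<in>?P. ?E (set A))"
    unfolding kernel_edges_def by fastforce
  then have "card ((\<lambda>(u, v). {u, v}) ` set (kernel_edges d vs es))
      \<le> card (?E (set ?X) \<union> (\<Union>A\<in>?P. ?E (set A)))"
    by (intro card_mono) auto
  also have "\<dots> \<le> card (?E (set ?X)) + card (\<Union>A\<in>?P. ?E (set A))" by (rule card_Un_le)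
  \<comment> \<open>The edges inside the cover are at most quadratic in its size;
    \<open>2 \<le> d\<close> absorbs them.\<close>
  also have "card (?E (set ?X)) \<le> ?n"
  proof -
    have "length ?X ^ 2 \<le> (length ?X + 1) ^ 2" by (rule power_mono) simp_all
    also have "\<dots> \<le> ?n" using assms by (intro power_increasing) simp_all
    finally show ?thesis using card[of ?X] by simp
  qed
  also have "card (\<Union>A\<in>?P. ?E (set A)) \<le> ((d + 2) * (d + 1) + 1) * (2 * d + 2) ^ 2 * ?n"
  proof -
    have "card (\<Union>A\<in>?P. ?E (set A)) \<le> (\<Sum>A\<in>?P. card (?E (set A)))"
      by (rule card_UN_le) simp
    also have "\<dots> \<le> (\<Sum>A\<in>?P. (2 * d + 2) ^ 2)"
      by (intro sum_mono order_trans[OF card] power_mono length_piece_le) simp_all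
    also have "\<dots> = card ?P * (2 * d + 2) ^ 2" by simp
    also have "\<dots> \<le> ((d + 2) * (d + 1) + 1) * ?n * (2 * d + 2) ^ 2"
      by (intro mult_right_mono order_trans[OF card_length length_pieces_le]) simp
    finally show ?thesis by (simp only: ac_simps)
  qed
  finally show ?thesis by (simp add: size_const_def algebra_simps)
qed

section \<open>The bit encoding\<close>

text \<open>Addition of a carry to a bit string, least significant bit first: the recursive
  counterpart of the fold in \<open>incr\<close>.\<close>

primrec ripple :: "bool \<Rightarrow> bool list \<Rightarrow> bool \<times> bool list" where
  "ripple c [] = (c, [])"
| "ripple c (b # bs) = (fst (ripple (c \<and> b) bs), (c \<noteq> b) # snd (ripple (c \<and> b) bs))"

lemma incr_eq_ripple: "incr bs = (fst (ripple True bs), rev (snd (ripple True bs)))"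
proof -
  have "foldl (\<lambda>st b. (fst st \<and> b, (fst st \<noteq> b) # snd st)) (c, acc) bs
      = (fst (ripple c bs), rev (snd (ripple c bs)) @ acc)" for c acc
    by (induction bs arbitrary: c acc) auto
  then show ?thesis by (simp add: incr_def)
qed

lemma fixed_bits_0: "fixed_bits 0 n = []"
  by (simp add: fixed_bits_def)

lemma fixed_bits_Suc: "fixed_bits (Suc w) n = odd n # fixed_bits w (n div 2)"
proof -
  have "[0..<Suc w] = 0 # map Suc [0..<w]" by (simp add: map_Suc_upt upt_conv_Cons del: upt_Suc)
  then show ?thesis by (simp add: fixed_bits_def o_def bit_0 bit_Suc del: upt_Suc)
qed

lemma fixed_bits_zero: "fixed_bits w 0 = replicate w False"
  by (induction w) (simp_all add: fixed_bits_0 fixed_bits_Suc)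

text \<open>Both sides work modulo \<open>2 ^ w\<close>: the final carry is dropped on the left, and
  \<open>fixed_bits\<close> truncates on the right.\<close>

lemma ripple_fixed_bits: "snd (ripple c (fixed_bits w n)) = fixed_bits w (n + of_bool c)"
proof (induction w arbitrary: c n)
  case (Suc w)
  \<comment> \<open>Halving passes on the carry \<open>c \<and> odd n\<close>.\<close>
  have "(n + of_bool c) div 2 = n div 2 + of_bool (c \<and> odd n)"
    by (cases c) (auto elim: oddE)
  then show ?case by (simp add: fixed_bits_Suc Suc) auto
qed (simp add: fixed_bits_0)

text \<open>Without a fixed width, a final carry becomes the new most significant bit.\<close>

lemma ripple_nat_bits:
  "snd (ripple c (nat_bits n)) @ (if fst (ripple c (nat_bits n)) then [True] else [])
    = nat_bits (n + of_bool c)"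
proof (induction n arbitrary: c rule: less_induct)
  case (less n)
  show ?case
  proof (cases "n = 0")
    case True
    have "nat_bits 0 = []" by (simp add: nat_bits.simps)
    moreover have "nat_bits 1 = [True]" by (subst nat_bits.simps) (simp add: calculation)
    ultimately show ?thesis using True by simp
  next
    case False
    have div: "(n + of_bool c) div 2 = n div 2 + of_bool (c \<and> odd n)"
      by (cases c) (auto elim: oddE)
    have n: "nat_bits n = odd n # nat_bits (n div 2)" using False by (subst nat_bits.simps) simp
    have "nat_bits (n + of_bool c) = odd (n + of_bool c) # nat_bits (n div 2 + of_bool (c \<and> odd n))"
      using False div by (subst nat_bits.simps) simp
    also have "nat_bits (n div 2 + of_bool (c \<and> odd n)) =
        snd (ripple (c \<and> odd n) (nat_bits (n div 2))) @
        (if fst (ripple (c \<and> odd n) (nat_bits (n div 2))) then [True] else [])"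
      using less.IH[of "n div 2" "c \<and> odd n"] False by simp
    finally show ?thesis unfolding n by auto
  qed
qed

lemma length_bits_eq: "length_bits vs = nat_bits (length vs)"
proof (induction vs rule: rev_induct)
  case Nil
  then show ?case by (simp add: length_bits_def nat_bits.simps)
next
  case (snoc v vs)
  then show ?case
    using ripple_nat_bits[of True "length vs"]
    by (simp add: length_bits_def incr_bits_def incr_eq_ripple)
qed

text \<open>The counter starts at zero and is incremented once per vertex before \<open>u\<close>,
  so it arrives at the position of \<open>u\<close> in \<open>vs\<close>.\<close>

lemma vertex_code_eq:
  "vertex_code vs u =
    fixed_bits (length (nat_bits (length vs))) (length (takeWhile (\<lambda>v. v \<noteq> u) vs))"
proof -
  have "foldl (\<lambda>b _. incr_fixed b) (fixed_bits w 0) l = fixed_bits w (length l)"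
    for w and l :: "nat list"
  proof (induction l rule: rev_induct)
    case (snoc x l)
    then show ?case
      using ripple_fixed_bits[of True w "length l"] by (simp add: incr_fixed_def incr_eq_ripple)
  qed simp
  moreover have "map (\<lambda>_. False) (length_bits vs) = fixed_bits (length (nat_bits (length vs))) 0"
    by (simp add: length_bits_eq fixed_bits_zero map_replicate_const)
  ultimately show ?thesis by (simp add: vertex_code_def)
qed

lemma graph_bits_eq:
  "graph_bits vs es = bit_code (length vs)
    (map (\<lambda>(u, v). (length (takeWhile (\<lambda>v. v \<noteq> u) vs), length (takeWhile (\<lambda>w. w \<noteq> v) vs))) es)"
  by (simp add: graph_bits_def bit_code_def vertex_code_eq map_replicate_const o_def split_beta)

lemma length_takeWhile_less: "\<exists>x\<in>set xs. \<not> P x \<Longrightarrow> length (takeWhile P xs) < length xs"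
  by (induction xs) auto

text \<open>The relabelling is the position in \<open>vs\<close>, with indexing as its
  inverse.\<close>

lemma bits_encode_graph_bits:
  assumes "lists_graph vs es G"
  shows "bits_encode (graph_bits vs es) G"
proof -
  let ?\<phi> = "\<lambda>u. length (takeWhile (\<lambda>v. v \<noteq> u) vs)"
  have vs: "distinct vs" "set vs = verts G" using assms by (auto simp: lists_graph_def)
  then have card: "card (verts G) = length vs" by (metis distinct_card)
  have lt: "?\<phi> u < length vs" if "u \<in> set vs" for u
    using that by (intro length_takeWhile_less) auto
  have nth: "vs ! ?\<phi> u = u" if "u \<in> set vs" for u
    using nth_length_takeWhile[OF lt[OF that]] by simp
  have inj: "inj_on ?\<phi> (set vs)"
    by (rule inj_on_inverseI[where g = "\<lambda>i. vs ! i"]) (rule nth)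
  then have "card (?\<phi> ` set vs) = card {0..<length vs}"
    using vs(1) by (simp add: card_image distinct_card)
  then have "?\<phi> ` set vs = {0..<length vs}"
    using lt by (intro card_subset_eq) auto
  with inj have "bij_betw ?\<phi> (verts G) {0..<card (verts G)}"
    unfolding bij_betw_def card vs(2) by blast
  then show ?thesis
    unfolding bits_encode_def using assms card
    by (intro exI[of _ vs] exI[of _ es] exI[of _ ?\<phi>]) (simp add: graph_bits_eq)
qed

text \<open>A number is at least the value of its highest digit, which is 1 as there are no leading
  zeros.\<close>

lemma power_length_nat_bits: "0 < n \<Longrightarrow> 2 ^ (length (nat_bits n) - 1) \<le> n"
proof (induction n rule: less_induct)
  case (less n)
  have n: "nat_bits n = odd n # nat_bits (n div 2)" using less.prems by (subst nat_bits.simps) simp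
  show ?case
  proof (cases "n = 1")
    case True
    then show ?thesis using n by (simp add: nat_bits.simps)
  next
    case False
    then have pos: "0 < n div 2" using less.prems by auto
    then have "nat_bits (n div 2) \<noteq> []" by (subst nat_bits.simps) simp
    then have "length (nat_bits n) - 1 = Suc (length (nat_bits (n div 2)) - 1)"
      using n by (cases "nat_bits (n div 2)") auto
    moreover have "2 ^ (length (nat_bits (n div 2)) - 1) \<le> n div 2"
      using less.IH[OF _ pos] less.prems by simp
    ultimately show ?thesis by simp
  qed
qed

lemma length_nat_bits_le:
  assumes "real n \<le> b" and "1 \<le> b"
  shows "real (length (nat_bits n)) \<le> log 2 b + 1"
proof (cases "n = 0")
  case True
  then show ?thesis using assms by (simp add: nat_bits.simps)
next
  case False
  then have "2 ^ (length (nat_bits n) - 1) \<le> n" by (intro power_length_nat_bits) simp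
  then have "real (2 ^ (length (nat_bits n) - 1)) \<le> real n" by (rule of_nat_mono)
  then have "2 ^ (length (nat_bits n) - 1) \<le> b" using assms(1) unfolding of_nat_power of_nat_numeral by linarith
  then have "real (length (nat_bits n) - 1) \<le> log 2 b"
    using assms(2) by (simp add: le_log_iff powr_realpow)
  then show ?thesis by linarith
qed

lemma length_bit_code:
  "length (bit_code n es) = n + 1 + length es * (2 * length (nat_bits n))"
  by (simp add: bit_code_def length_concat o_def split_beta fixed_bits_def sum_list_triv)

section \<open>Correctness of the kernel\<close>

lemma simple_graph_edge_at:
  assumes "simple_graph H" and "e \<in> edges H" and "x \<in> e"
  obtains y where "e = {x, y}" "y \<in> verts H" "x \<noteq> y"
proof -
  obtain u v where uv: "u \<in> verts H" "v \<in> verts H" "u \<noteq> v" "e = {u, v}"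
    using assms(1,2) unfolding simple_graph_def by blast
  then have "x = u \<or> x = v" using assms(3) by simp
  then show ?thesis
    using that[of v] that[of u] uv by (auto simp: insert_commute)
qed

text \<open>If all degrees were at most 1, the edges would be pairwise disjoint, and one chosen end
  of each edge would form a side of a bipartition.\<close>

lemma max_degree_ge_2:
  assumes H: "simple_graph H" and "\<not> bipartite H"
  shows "2 \<le> max_degree H"
proof (rule ccontr)
  assume "\<not> 2 \<le> max_degree H"
  then have deg: "max_degree H \<le> 1" by simp
  have uniq: "e = e'" if e: "e \<in> edges H" "x \<in> e" and e': "e' \<in> edges H" "x \<in> e'" for e e' x
  proof -
    obtain y where y: "e = {x, y}" using H e by (rule simple_graph_edge_at)
    obtain y' where y': "e' = {x, y'}" using H e' by (rule simple_graph_edge_at)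
    have "x \<in> verts H" using simple_graph_edgeD(1)[OF H] e(1) y by blast
    then have "finite {y, y'}" "card {y, y'} \<le> max_degree H"
      using neighbours_card_le[OF H, of x "{y, y'}"] y y' e(1) e'(1) by auto
    then have "y = y'" using deg by (cases "y = y'") auto
    then show ?thesis using y y' by simp
  qed
  have ne: "(SOME x. x \<in> e) \<in> e" if "e \<in> edges H" for e
    using H that unfolding simple_graph_def by (metis insertI1 some_in_eq empty_iff)
  define A where "A = (\<lambda>e. SOME x. x \<in> e) ` edges H"
  have "e \<subseteq> verts H" if "e \<in> edges H" for e
    using H that unfolding simple_graph_def by auto
  then have "A \<subseteq> verts H" using ne unfolding A_def by blast
  moreover have "\<exists>a\<in>A. \<exists>b\<in>verts H - A. e = {a, b}" if e: "e \<in> edges H" for e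
  proof -
    define a where "a = (SOME x. x \<in> e)"
    have a: "a \<in> e" "a \<in> A" using ne e by (auto simp: a_def A_def)
    obtain b where b: "e = {a, b}" "b \<in> verts H" "a \<noteq> b"
      using H e a(1) by (rule simple_graph_edge_at)
    have "b \<notin> A"
    proof
      assume "b \<in> A"
      then obtain e' where e': "e' \<in> edges H" "b = (SOME x. x \<in> e')" by (auto simp: A_def)
      then have "e' = e" using uniq[OF e'(1) _ e, of b] ne[OF e'(1)] b(1) by simp
      then show False using e'(2) b(3) a_def by simp
    qed
    then show ?thesis using a(2) b by blast
  qed
  ultimately have "bipartite H"
    unfolding bipartite_def by (intro exI[of _ A] exI[of _ "verts H - A"]) auto
  with assms(2) show False ..
qed

definition kernel_graph :: "nat \<Rightarrow> nat list \<Rightarrow> (nat \<times> nat) list \<Rightarrow> nat ugraph" where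
  "kernel_graph d vs es =
     \<lparr>verts = set (endpoints vs (kernel_edges d vs es)),
      edges = (\<lambda>(u, v). {u, v}) ` set (kernel_edges d vs es)\<rparr>"

lemma
  assumes G: "simple_graph G" "lists_graph vs es G"
  shows lists_graph_kernel:
      "lists_graph (endpoints vs (kernel_edges d vs es)) (kernel_edges d vs es) (kernel_graph d vs es)"
    and simple_graph_kernel: "simple_graph (kernel_graph d vs es)"
    and subgraph_kernel: "subgraph (kernel_graph d vs es) G"
proof -
  have vs: "distinct vs" "set vs = verts G" and es: "distinct (map (\<lambda>(u, v). {u, v}) es)"
    "edges G = (\<lambda>(u, v). {u, v}) ` set es"
    using G(2) by (auto simp: lists_graph_def)
  have sub: "set (kernel_edges d vs es) \<subseteq> set es" by (auto simp: kernel_edges_def)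
  show "lists_graph (endpoints vs (kernel_edges d vs es)) (kernel_edges d vs es) (kernel_graph d vs es)"
    using vs(1) es(1)
    by (simp add: lists_graph_def kernel_graph_def endpoints_def kernel_edges_def distinct_map_filter)
  have "\<exists>u\<in>set (endpoints vs (kernel_edges d vs es)). \<exists>v\<in>set (endpoints vs (kernel_edges d vs es)).
      u \<noteq> v \<and> e = {u, v}" if e: "e \<in> edges (kernel_graph d vs es)" for e
  proof -
    obtain u v where uv: "(u, v) \<in> set (kernel_edges d vs es)" "e = {u, v}"
      using e by (auto simp: kernel_graph_def)
    then have "{u, v} \<in> edges G" using sub by (auto simp: lists_graph_edge_iff[OF G(2)])
    note simple_graph_edgeD[OF G(1) this]
    moreover have "u \<in> set (endpoints vs (kernel_edges d vs es))"
      "v \<in> set (endpoints vs (kernel_edges d vs es))"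
      using uv(1) calculation vs(2) unfolding endpoints_def by force+
    ultimately show ?thesis using uv(2) by blast
  qed
  then show "simple_graph (kernel_graph d vs es)"
    unfolding simple_graph_def by (simp add: kernel_graph_def)
  show "subgraph (kernel_graph d vs es) G"
    using sub vs es unfolding subgraph_def kernel_graph_def endpoints_def by auto
qed

text \<open>Restriction gives one direction; the other is \<open>kernel_coloring.colorable\<close>,
  applied to the colouring extended by a constant outside the kernel.\<close>

lemma colorable_kernel_iff:
  assumes H: "simple_graph H" and "verts H \<noteq> {}" and G: "simple_graph G" "lists_graph vs es G"
  shows "colorable H (kernel_graph (max_degree H) vs es) \<longleftrightarrow> colorable H G"
proof
  assume "colorable H G"
  then show "colorable H (kernel_graph (max_degree H) vs es)"
    using subgraph_kernel[OF G, of "max_degree H"] unfolding colorable_def subgraph_def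
    by (meson image_mono subset_eq order_trans)
next
  let ?G = "kernel_graph (max_degree H) vs es"
  assume "colorable H ?G"
  then obtain f where f: "f ` verts ?G \<subseteq> verts H" "\<And>u v. {u, v} \<in> edges ?G \<Longrightarrow> {f u, f v} \<in> edges H"
    unfolding colorable_def by blast
  obtain h where h: "h \<in> verts H" using assms(2) by blast
  define f' where "f' x = (if x \<in> verts ?G then f x else h)" for x
  interpret kernel_coloring H G vs es f' "max_degree H"
  proof
    show "f' x \<in> verts H" for x using f(1) h by (auto simp: f'_def)
    fix u v
    assume "(u, v) \<in> set (kernel_edges (max_degree H) vs es)"
    then have e: "{u, v} \<in> edges ?G" by (force simp: kernel_graph_def)
    then show "{f' u, f' v} \<in> edges H"
      using f(2) simple_graph_edgeD[OF simple_graph_kernel[OF G] e] by (simp add: f'_def)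
  qed (use H G in auto)
  show "colorable H G" by (rule colorable)
qed

text \<open>The computed cover has at most \<open>2 * card Y\<close> vertices for any twin-cover
  \<open>Y\<close>. Every vertex of the kernel is an end of a kept edge, whence the factor 2 for the
  vertices.\<close>

lemma card_kernel_le:
  assumes G: "simple_graph G" "lists_graph vs es G" and "2 \<le> d"
    and "twin_cover G Y"
  shows "length (kernel_edges d vs es) \<le> size_const d * (2 * card Y + 1) ^ d"
    and "length (endpoints vs (kernel_edges d vs es)) \<le> 2 * (size_const d * (2 * card Y + 1) ^ d)"
proof -
  let ?es = "kernel_edges d vs es"
  note lg = lists_graph_kernel[OF G, of d]
  have "length ?es = card (set (map (\<lambda>(u, v). {u, v}) ?es))"
    using lg distinct_card[of "map (\<lambda>(u, v). {u, v}) ?es"] by (simp add: lists_graph_def)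
  also have "\<dots> = card ((\<lambda>(u, v). {u, v}) ` set ?es)" by simp
  also have "\<dots> \<le> size_const d * (length (cover vs es) + 1) ^ d"
    by (rule card_kernel_edges_le[OF assms(3)])
  also have "\<dots> \<le> size_const d * (2 * card Y + 1) ^ d"
    using length_cover_le[OF G assms(4)] by (intro mult_left_mono power_mono) auto
  finally show 1: "length ?es \<le> size_const d * (2 * card Y + 1) ^ d" .
  have "length (endpoints vs ?es) = card (set (endpoints vs ?es))"
    using lg distinct_card[of "endpoints vs ?es"] by (simp add: lists_graph_def)
  also have "\<dots> \<le> card (set (map fst ?es @ map snd ?es))"
    by (intro card_mono) (auto simp: endpoints_def)
  also have "\<dots> \<le> length (map fst ?es @ map snd ?es)" by (rule card_length)
  finally show "length (endpoints vs ?es) \<le> 2 * (size_const d * (2 * card Y + 1) ^ d)" using 1 by simp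
qed

section \<open>Asymptotic form of the size bounds\<close>

lemma bigo_power: "(\<lambda>k. c * (2 * real k + 1) ^ d) \<in> O(\<lambda>k. real k ^ d)"
proof (rule bigoI[where c = "\<bar>c\<bar> * 3 ^ d"])
  show "\<forall>\<^sub>F k in sequentially. norm (c * (2 * real k + 1) ^ d) \<le> \<bar>c\<bar> * 3 ^ d * norm (real k ^ d)"
    using eventually_ge_at_top[of 1]
  proof eventually_elim
    case (elim k)
    have "(2 * real k + 1) ^ d \<le> (3 * real k) ^ d" using elim by (intro power_mono) auto
    then have "\<bar>c\<bar> * (2 * real k + 1) ^ d \<le> \<bar>c\<bar> * (3 * real k) ^ d" by (intro mult_left_mono) auto
    then show ?case by (simp add: abs_mult power_mult_distrib)
  qed
qed

text \<open>With \<open>b\<close> bounding both vertices and edges, the expression adds up the unary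
  part, the separator and two vertex codes of at most \<open>log 2 (b k) + 1\<close> bits per edge.
  From \<open>k = 2\<close> on, \<open>log 2 (real k)\<close> is at least 1 and absorbs the
  constants.\<close>

lemma bigo_power_log:
  fixes c :: real and d :: nat
  assumes "1 \<le> c"
  defines "b \<equiv> \<lambda>k. c * (2 * real k + 1) ^ d"
  shows "(\<lambda>k. b k + 1 + b k * (2 * (log 2 (b k) + 1))) \<in> O(\<lambda>k. real k ^ d * log 2 (real k))"
proof -
  let ?c = "c * 3 ^ d"
  have c: "1 \<le> ?c" using assms(1) mult_mono[of 1 c 1 "3 ^ d"] by simp
  show ?thesis
  proof (rule bigoI[where c = "?c + 1 + ?c * (2 * (log 2 ?c + d + 1))"])
    show "\<forall>\<^sub>F k in sequentially. norm (b k + 1 + b k * (2 * (log 2 (b k) + 1)))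
      \<le> (?c + 1 + ?c * (2 * (log 2 ?c + d + 1))) * norm (real k ^ d * log 2 (real k))"
      using eventually_ge_at_top[of 2]
    proof eventually_elim
      case (elim k)
      let ?L = "log 2 (real k)"
      have L: "1 \<le> ?L" using elim by (simp add: le_log_iff)
      have b1: "1 \<le> b k"
        unfolding b_def using mult_mono[of 1 c 1 "(2 * real k + 1) ^ d"] assms(1) by simp
      have "(2 * real k + 1) ^ d \<le> (3 * real k) ^ d" using elim by (intro power_mono) auto
      then have "b k \<le> c * (3 * real k) ^ d"
        unfolding b_def using assms(1) by (intro mult_left_mono) auto
      then have bk: "b k \<le> ?c * real k ^ d" by (simp add: power_mult_distrib)
      have "log 2 (b k) \<le> log 2 (?c * real k ^ d)" using b1 bk c elim by simp
      also have "\<dots> = log 2 ?c + d * ?L"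
        using c elim assms(1) by (simp add: log_mult log_nat_power del: log_mult_pos)
      also have "\<dots> \<le> log 2 ?c * ?L + d * ?L"
        using mult_left_mono[OF L, of "log 2 ?c"] c by simp
      finally have lb: "log 2 (b k) + 1 \<le> (log 2 ?c + d + 1) * ?L"
        using L by (simp add: algebra_simps)
      have lpos: "0 \<le> log 2 (b k)" using b1 by simp
      have kd: "1 \<le> real k ^ d" using elim by (intro one_le_power) simp
      have "0 \<le> ?c * real k ^ d" using assms(1) by simp
      from mult_left_mono[OF L this] have "b k \<le> ?c * (real k ^ d * ?L)"
        using bk by (simp add: mult.assoc)
      moreover have "1 \<le> real k ^ d * ?L" using mult_mono[OF kd L] kd by simp
      moreover have "b k * (2 * (log 2 (b k) + 1)) \<le> (?c * real k ^ d) * (2 * ((log 2 ?c + d + 1) * ?L))"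
        using bk lb b1 lpos c kd by (intro mult_mono) auto
      ultimately have "b k + 1 + b k * (2 * (log 2 (b k) + 1))
          \<le> (?c + 1 + ?c * (2 * (log 2 ?c + d + 1))) * (real k ^ d * ?L)"
        by (simp add: algebra_simps)
      moreover have "0 \<le> b k + 1 + b k * (2 * (log 2 (b k) + 1))" using b1 lpos by simp
      moreover have "0 \<le> real k ^ d * ?L" using kd L by simp
      ultimately show ?case by simp
    qed
  qed
qed

lemma enc_graph: "enc (vs, es) = graph_tree vs es"
proof -
  have "enc es = list_tree (map (\<lambda>(u, v). Node (nat_tree u) (nat_tree v)) es)"
    by (induction es) (auto simp: enc_nat_def)
  then show ?thesis by (simp add: graph_tree_def enc_list_def enc_nat_def)
qed

text \<open>The algorithm is given neither \<open>k\<close> nor a twin-cover, so the bounds hold at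
  once for the size of every twin-cover of \<open>G\<close>.\<close>

theorem theorem21:
  fixes H :: "'h ugraph"
  assumes "simple_graph H" and "\<not> bipartite H"
  shows "\<exists>(kernel :: tree \<Rightarrow> tree) (size_bound :: nat \<Rightarrow> real) (bits_bound :: nat \<Rightarrow> real).
    polytime_on {x. \<exists>G. simple_graph G \<and> tree_encodes x G} kernel \<and>
    size_bound \<in> O(\<lambda>k. real k ^ max_degree H) \<and>
    bits_bound \<in> O(\<lambda>k. real k ^ max_degree H * log 2 (real k)) \<and>
    (\<forall>G x. simple_graph G \<and> tree_encodes x G \<longrightarrow>
      (\<exists>G' x' w. kernel x = Node x' (bits_tree w) \<and>
        simple_graph G' \<and> tree_encodes x' G' \<and> bits_encode w G' \<and>
        subgraph G' G \<and>
        (colorable H G' \<longleftrightarrow> colorable H G) \<and>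
        (\<forall>k. (\<exists>X. twin_cover G X \<and> card X = k) \<longrightarrow>
          real (card (verts G')) \<le> size_bound k \<and>
          real (card (edges G')) \<le> size_bound k \<and>
          real (length w) \<le> bits_bound k)))"
proof -
  let ?d = "max_degree H"
  let ?kernel = "\<lambda>x. enc (kernelize ?d (inv enc x))"
  \<comment> \<open>The factor 2 pays for the vertices, of which there may be two per kept
    edge.\<close>
  define c where "c = 2 * real (size_const ?d)"
  define b where "b k = c * (2 * real k + 1) ^ ?d" for k
  have c: "1 \<le> c" by (simp add: c_def size_const_def)
  have d2: "2 \<le> ?d" using assms by (rule max_degree_ge_2)
  have ne: "verts H \<noteq> {}"
  proof
    assume "verts H = {}"
    then have "edges H = {}" using assms(1) by (auto simp: simple_graph_def)
    then have "bipartite H" using \<open>verts H = {}\<close> by (auto simp: bipartite_def)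
    with assms(2) show False ..
  qed
  \<comment> \<open>Every input in the domain is the code of a pair of lists, so
    \<open>inv enc\<close> decodes it correctly.\<close>
  have "{x. \<exists>G. simple_graph G \<and> tree_encodes x G} \<subseteq> range (enc :: nat list \<times> (nat \<times> nat) list \<Rightarrow> tree)"
    unfolding tree_encodes_def enc_graph[symmetric] by blast
  then have poly: "polytime_on {x. \<exists>G. simple_graph G \<and> tree_encodes x G} ?kernel"
    using polytime_on_enc[OF polytime_kernelize, of ?d] unfolding polytime_on_def by blast
  have "\<exists>G' x' w. ?kernel x = Node x' (bits_tree w) \<and>
      simple_graph G' \<and> tree_encodes x' G' \<and> bits_encode w G' \<and> subgraph G' G \<and>
      (colorable H G' \<longleftrightarrow> colorable H G) \<and>
      (\<forall>k. (\<exists>X. twin_cover G X \<and> card X = k) \<longrightarrow> real (card (verts G')) \<le> b k \<and>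
        real (card (edges G')) \<le> b k \<and> real (length w) \<le> b k + 1 + b k * (2 * (log 2 (b k) + 1)))"
    if G: "simple_graph G" and x: "tree_encodes x G" for G x
  proof -
    obtain vs es where lg: "lists_graph vs es G" and x: "x = enc (vs, es)"
      using x unfolding tree_encodes_def enc_graph[symmetric] by blast
    let ?es = "kernel_edges ?d vs es"
    let ?vs = "endpoints vs ?es"
    let ?G = "kernel_graph ?d vs es"
    let ?w = "graph_bits ?vs ?es"
    note lg' = lists_graph_kernel[OF G lg, of ?d]
    have "inv enc x = (vs, es)" by (simp only: x inv_f_f[OF inj_enc])
    then have "?kernel x = Node (graph_tree ?vs ?es) (bits_tree ?w)"
      by (simp add: kernelize_def enc_graph[symmetric])
        (simp add: bits_tree_def enc_list_def enc_bool_def)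
    moreover have "tree_encodes (graph_tree ?vs ?es) ?G" using lg' by (auto simp: tree_encodes_def)
    moreover have "real (card (verts ?G)) \<le> b k \<and> real (card (edges ?G)) \<le> b k \<and>
        real (length ?w) \<le> b k + 1 + b k * (2 * (log 2 (b k) + 1))"
      if X: "twin_cover G X" "card X = k" for X k
    proof -
      note le = card_kernel_le[OF G lg d2 X(1)]
      have b: "b k = real (2 * (size_const ?d * (2 * k + 1) ^ ?d))" by (simp add: b_def c_def add.commute)
      have v: "real (length ?vs) \<le> b k" using le(2) unfolding b X(2) by (rule of_nat_mono)
      have "length ?es \<le> 2 * (size_const ?d * (2 * k + 1) ^ ?d)" using le(1) unfolding X(2) by simp
      then have e: "real (length ?es) \<le> b k" unfolding b by (rule of_nat_mono)
      have b1: "1 \<le> b k"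
        unfolding b_def using mult_mono[of 1 c 1 "(2 * real k + 1) ^ ?d"] c by simp
      have "card (verts ?G) = length ?vs"
        using lg' distinct_card[of ?vs] by (simp add: lists_graph_def)
      moreover have "card (edges ?G) \<le> length ?es"
        using card_image_le[of "set ?es" "\<lambda>(u, v). {u, v}"] card_length[of ?es]
        by (simp add: kernel_graph_def)
      moreover have "real (length ?w) \<le> b k + 1 + b k * (2 * (log 2 (b k) + 1))"
      proof -
        have "real (length ?w) = length ?vs + 1 + length ?es * (2 * length (nat_bits (length ?vs)))"
          by (simp add: graph_bits_eq length_bit_code)
        also have "\<dots> \<le> b k + 1 + b k * (2 * (log 2 (b k) + 1))"
          unfolding of_nat_add of_nat_mult of_nat_1
          using v e length_nat_bits_le[OF v b1] b1 by (intro add_mono mult_mono) auto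
        finally show ?thesis .
      qed
      ultimately show ?thesis using v e by simp
    qed
    ultimately show ?thesis
      using simple_graph_kernel[OF G lg] subgraph_kernel[OF G lg] bits_encode_graph_bits[OF lg']
        colorable_kernel_iff[OF assms(1) ne G lg] by blast
  qed
  moreover have "b \<in> O(\<lambda>k. real k ^ ?d)" unfolding b_def by (rule bigo_power)
  moreover have "(\<lambda>k. b k + 1 + b k * (2 * (log 2 (b k) + 1))) \<in> O(\<lambda>k. real k ^ ?d * log 2 (real k))"
    unfolding b_def by (rule bigo_power_log[OF c])
  ultimately show ?thesis using poly
    by (intro exI[of _ ?kernel] exI[of _ b]
        exI[of _ "\<lambda>k. b k + 1 + b k * (2 * (log 2 (b k) + 1))"]) simp
qed

end
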